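(* Let $X$ be a metric space and let $\pi:X\times\mathcal{B}(X)\to[0,1]$ be a transition function for a discrete-time Markov chain $\Phi$. Assume that there exists $z\in X$ such that for every $\varepsilon>0$ there exists $\alpha>0$ such that $$\liminf_{n\to\infty}\pi^n(x,B(z,\varepsilon))\ge\alpha\quad\text{for every }x\in X.$$ If for every $\varphi\in C_b(X)$ the family of functions $\left\{x\mapsto\int_X\varphi(y)\,\pi^n(x,dy):n\in\mathbb{N}\right\}$ is equicontinuous (at every point of $X$), then $\Phi$ has a unique invariant probability measure $\mu_{\ast}$, and for every $\mu\in\mathcal{M}_1(X)$ the measures $\int_X\pi^n(x,\cdot)\,\mu(dx)$ converge weakly to $\mu_{\ast}$ as $n\to\infty$.
   Context: $X$ is an arbitrary metric space (not assumed separable or complete). $B(x,r)$ is the open ball with centre $x$ and radius $r$; $\mathcal{B}(X)$ is the Borel $\sigma$-algebra; $C_b(X)$ is the space of real bounded continuous functions on $X$; $\mathcal{M}_1(X)$ is the set of (countably additive) Borel probability measures on $X$. A transition function $\pi$ is a Markov (probability) kernel: $\pi(x,\cdot)\in\mathcal{M}_1(X)$ for each $x$, and $\pi(\cdot,A)$ is Borel measurable for each $A\in\mathcal{B}(X)$. Its iterates are $\pi^1=\pi$, $\pi^{n+1}(x,A)=\int_X\pi^n(y,A)\,\pi(x,dy)$. A measure $\mu_{\ast}\in\mathcal{M}_1(X)$ is invariant for $\Phi$ if $\int_X\pi(x,A)\,\mu_{\ast}(dx)=\mu_{\ast}(A)$ for all $A\in\mathcal{B}(X)$. Measures $\mu_n$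 converge weakly to $\mu_{\ast}$ if $\int\varphi\,d\mu_n\to\int\varphi\,d\mu_{\ast}$ for every $\varphi\in C_b(X)$. A family $\{f_n\}$ of functions is equicontinuous at $x$ if $\lim_{y\to x}\sup_n|f_n(y)-f_n(x)|=0$. *)

theory Defs
  imports "HOL-Probability.Probability"
begin

abbreviation borel_prob_measures :: "'a::topological_space measure set" where
  "borel_prob_measures \<equiv> {\<mu>. prob_space \<mu> \<and> sets \<mu> = sets borel}"

definition transition_function :: "('a::topological_space \<Rightarrow> 'a measure) \<Rightarrow> bool" where
  "transition_function \<pi> \<longleftrightarrow>
     (\<forall>x. \<pi> x \<in> borel_prob_measures) \<and>
     (\<forall>A \<in> sets borel. (\<lambda>x. measure (\<pi> x) A) \<in> borel_measurable borel)"

lemma transition_function_iff_measurable_prob_algebra: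
  "transition_function \<pi> \<longleftrightarrow> \<pi> \<in> borel \<rightarrow>\<^sub>M prob_algebra borel"
proof
  assume "transition_function \<pi>"
  then have p: "\<And>x. prob_space (\<pi> x)" "\<And>x. sets (\<pi> x) = sets borel"
    and m: "\<And>A. A \<in> sets borel \<Longrightarrow> (\<lambda>x. measure (\<pi> x) A) \<in> borel_measurable borel"
    by (auto simp: transition_function_def)
  have "emeasure (\<pi> x) A = ennreal (measure (\<pi> x) A)" for x A
  proof -
    interpret prob_space "\<pi> x" by (rule p)
    show ?thesis by (rule emeasure_eq_measure)
  qed
  then have "\<pi> \<in> borel \<rightarrow>\<^sub>M subprob_algebra borel"
    by (intro measurable_subprob_algebra)
       (auto simp: p prob_space_imp_subprob_space intro!: m measurable_compose[OF _ measurable_ennreal])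
  then show "\<pi> \<in> borel \<rightarrow>\<^sub>M prob_algebra borel"
    by (auto simp: prob_algebra_def p intro!: measurable_restrict_space2)
next
  assume m: "\<pi> \<in> borel \<rightarrow>\<^sub>M prob_algebra borel"
  then have "\<pi> x \<in> space (prob_algebra borel)" for x
    by (rule measurable_space) simp
  moreover have "(\<lambda>x. measure (\<pi> x) A) \<in> borel_measurable borel" if "A \<in> sets borel" for A
    using measurable_compose[OF measurable_prob_algebraD[OF m] measurable_measure_subprob_algebra[OF that]] .
  ultimately show "transition_function \<pi>"
    by (auto simp: transition_function_def space_prob_algebra)
qed

text \<open>
  The index is shifted so that \<open>\<pi>\<^sup>0(x,\<cdot>)\<close> is the point mass at \<open>x\<close>; the lemmas
  below recover \<open>\<pi>\<^sup>1 = \<pi>\<close> and the usual integral recursion.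
\<close>
primrec kernel_iterate :: "('a::topological_space \<Rightarrow> 'a measure) \<Rightarrow> nat \<Rightarrow> 'a \<Rightarrow> 'a measure" where
  "kernel_iterate \<pi> 0 = return borel"
| "kernel_iterate \<pi> (Suc n) = (\<lambda>x. bind (\<pi> x) (kernel_iterate \<pi> n))"

lemma kernel_iterate_measurable:
  assumes "transition_function \<pi>"
  shows "kernel_iterate \<pi> n \<in> borel \<rightarrow>\<^sub>M prob_algebra borel"
proof (induction n)
  case 0
  then show ?case
    by (auto simp: prob_algebra_def prob_space_return intro!: measurable_restrict_space2 return_measurable)
next
  case (Suc n)
  then show ?case
    using assms
    by (auto simp: transition_function_iff_measurable_prob_algebra intro!: measurable_bind_prob_space)
qed

lemma kernel_iterate_1:
  assumes "transition_function \<pi>"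
  shows "kernel_iterate \<pi> 1 = \<pi>"
  using assms by (auto simp: transition_function_def fun_eq_iff intro!: bind_return'')

lemma measure_bind_kernel_iterate:
  assumes "transition_function \<pi>" "\<mu> \<in> borel_prob_measures" "A \<in> sets borel"
  shows "measure (bind \<mu> (kernel_iterate \<pi> n)) A = (\<integral>x. measure (kernel_iterate \<pi> n x) A \<partial>\<mu>)"
proof -
  from assms(2) interpret prob_space \<mu> by simp
  have "kernel_iterate \<pi> n \<in> \<mu> \<rightarrow>\<^sub>M subprob_algebra borel"
    using measurable_prob_algebraD[OF kernel_iterate_measurable[OF assms(1)], of n] assms(2)
    by (simp cong: measurable_cong_sets)
  then show ?thesis using assms(3) by (rule measure_bind)
qed

lemma measure_kernel_iterate_Suc:
  assumes "transition_function \<pi>" "A \<in> sets borel"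
  shows "measure (kernel_iterate \<pi> (Suc n) x) A = (\<integral>y. measure (kernel_iterate \<pi> n y) A \<partial>\<pi> x)"
  using assms by (auto simp: transition_function_def intro!: measure_bind_kernel_iterate)

definition invariant_prob_measure ::
  "('a::topological_space \<Rightarrow> 'a measure) \<Rightarrow> 'a measure \<Rightarrow> bool" where
  "invariant_prob_measure \<pi> \<mu> \<longleftrightarrow>
     \<mu> \<in> borel_prob_measures \<and>
     (\<forall>A \<in> sets borel. (\<integral>x. measure (\<pi> x) A \<partial>\<mu>) = measure \<mu> A)"

definition converges_weakly :: "(nat \<Rightarrow> 'a::topological_space measure) \<Rightarrow> 'a measure \<Rightarrow> bool" where
  "converges_weakly M \<mu> \<longleftrightarrow>
     (\<forall>\<phi> :: 'a \<Rightarrow> real. \<phi> \<in> bcontfun \<longrightarrow> (\<lambda>n. \<integral>x. \<phi> x \<partial>M n) \<longlonglongrightarrow> (\<integral>x. \<phi> x \<partial>\<mu>))"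

text \<open>The supremum is taken in \<open>[0,\<infinity>]\<close>, so that it is meaningful for unbounded families.\<close>
definition equicontinuous_at :: "('a::topological_space \<Rightarrow> real) set \<Rightarrow> 'a \<Rightarrow> bool" where
  "equicontinuous_at F x \<longleftrightarrow> ((\<lambda>y. SUP f\<in>F. ennreal \<bar>f y - f x\<bar>) \<longlongrightarrow> 0) (at x)"

end

theory Submission
  imports Defs
begin

text \<open>
  Write \<open>P n f x\<close> for the integral of \<open>f\<close> against \<open>\<pi>\<^sup>n(x, \<cdot>)\<close>. By equicontinuity, \<open>P n f\<close> is almost constant on a
  small ball around \<open>z\<close>, uniformly in \<open>n\<close>, and by the lower bound every initial law eventually puts a
  fixed mass on that ball. Splitting off this mass repeatedly shows that the integrals of \<open>P n f\<close> against any two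
  initial laws become equal. This yields uniqueness, and convergence once an invariant measure exists.

  For existence, the Cesaro averages of \<open>f\<close> are asymptotically Cauchy in \<open>L\<^sup>2\<close> along the laws \<open>\<pi>\<^sup>k(z, \<cdot>)\<close> by the
  argument of the mean ergodic theorem. Since these laws charge small balls around \<open>z\<close> and the averages are
  equicontinuous there, the averages converge at \<open>z\<close>. The limit is a positive functional on bounded
  continuous functions, which by Alexandrov's theorem inherits the Daniell property and is therefore
  integration against a measure, even though \<open>X\<close> need not be separable or complete.
\<close>

section \<open>Bounded continuous functions\<close>

text \<open>In this generality a single Borel probability measure need not be tight, so compactness
  cannot supply a weak limit point of the Cesaro averages. Convergence is therefore proved for each
  \<open>f\<close> separately, and a measure is recovered from the limits only afterwards. The
  Daniell property is handled in a restricted form, for sequences that vanish from some index on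
  near each point. Sums of increments of such a sequence are locally finite, hence continuous, which
  is what a gliding hump needs. The form still gives countable subadditivity, since truncating a
  test function clears a neighbourhood of its zero set. Squares enter through the parallelogram law,
  which turns almost minimal norm into closeness. No invariant measure is at hand to define an L2
  norm, so its square is replaced by the limsup over \<open>k\<close> of the integrals of the
  squared function against the laws at time \<open>k\<close>. Evaluation at the single point
  \<open>z\<close> suffices for existence, because Cesaro averages are asymptotically invariant
  under a shift in time.\<close>

lemma bcontfun_continuous: "f \<in> bcontfun \<Longrightarrow> continuous_on S f"
  by (auto simp: bcontfun_def intro: continuous_on_subset)

lemma bcontfun_borel_measurable:
  fixes f :: "'a::topological_space \<Rightarrow> real"
  assumes "f \<in> bcontfun" "sets M = sets borel"
  shows "f \<in> borel_measurable M"
  using borel_measurable_continuous_onI[OF bcontfun_continuous[OF assms(1)]] assms(2)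
  by (simp cong: measurable_cong_sets)

lemma bcontfun_boundE:
  fixes f :: "'a::topological_space \<Rightarrow> real"
  assumes "f \<in> bcontfun"
  obtains C where "C > 0" "\<And>x. \<bar>f x\<bar> \<le> C"
proof -
  from assms obtain C where "C > 0" "\<And>x. norm (f x) \<le> C"
    by (auto simp: bcontfun_def bounded_pos)
  then show ?thesis using that by auto
qed

lemma bcontfun_cmult:
  fixes f :: "'a::topological_space \<Rightarrow> real"
  shows "f \<in> bcontfun \<Longrightarrow> (\<lambda>x. c * f x) \<in> bcontfun"
  using scaleR_cont[of f c] by simp

lemma bcontfun_mult:
  fixes f g :: "'a::topological_space \<Rightarrow> real"
  assumes "f \<in> bcontfun" "g \<in> bcontfun"
  shows "(\<lambda>x. f x * g x) \<in> bcontfun"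
proof -
  obtain A B where "\<And>x. \<bar>f x\<bar> \<le> A" "\<And>x. \<bar>g x\<bar> \<le> B"
    using assms by (metis bcontfun_boundE)
  then have "norm (f x * g x) \<le> A * B" for x
    by (auto simp: abs_mult intro!: mult_mono order_trans[OF abs_ge_zero])
  then show ?thesis
    using assms by (intro bcontfun_normI) (auto simp: bcontfun_continuous intro!: continuous_on_mult)
qed

lemma bcontfun_power2:
  fixes f :: "'a::topological_space \<Rightarrow> real"
  shows "f \<in> bcontfun \<Longrightarrow> (\<lambda>x. (f x)\<^sup>2) \<in> bcontfun"
  using bcontfun_mult[of f f] by (simp add: power2_eq_square)

lemma bcontfun_sum:
  fixes f :: "'i \<Rightarrow> 'a::topological_space \<Rightarrow> real"
  assumes "\<And>i. i \<in> I \<Longrightarrow> f i \<in> bcontfun"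
  shows "(\<lambda>x. \<Sum>i\<in>I. f i x) \<in> bcontfun"
  using assms
proof (induction I rule: infinite_finite_induct)
  case (insert i I)
  then show ?case using plus_cont[of "f i" "\<lambda>x. \<Sum>i\<in>I. f i x"] by simp
qed (auto simp: const_bcontfun)

lemmas bcontfun_intros =
  const_bcontfun plus_cont minus_cont uminus_cont bcontfun_cmult bcontfun_mult bcontfun_power2 bcontfun_sum

lemma bcontfun_unit_intervalI:
  fixes f :: "'a::topological_space \<Rightarrow> real"
  shows "continuous_on UNIV f \<Longrightarrow> (\<And>x. 0 \<le> f x) \<Longrightarrow> (\<And>x. f x \<le> 1) \<Longrightarrow> f \<in> bcontfun"
  by (rule bcontfun_normI[where b = 1]) auto

lemma borel_prob_measures_space: "\<mu> \<in> borel_prob_measures \<Longrightarrow> space \<mu> = UNIV"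
  by (auto dest: sets_eq_imp_space_eq)

lemma integrable_bounded_borel:
  fixes f :: "'a::topological_space \<Rightarrow> real"
  assumes "\<mu> \<in> borel_prob_measures" "f \<in> borel_measurable borel" "\<And>x. \<bar>f x\<bar> \<le> C"
  shows "integrable \<mu> f"
proof -
  from assms interpret prob_space \<mu> by simp
  show ?thesis
    using assms by (intro integrable_const_bound[of _ C]) (auto cong: measurable_cong_sets)
qed

lemma integrable_bcontfun:
  fixes f :: "'a::topological_space \<Rightarrow> real"
  assumes "\<mu> \<in> borel_prob_measures" "f \<in> bcontfun"
  shows "integrable \<mu> f"
  using assms integrable_bounded_borel bcontfun_borel_measurable bcontfun_boundE by metis

lemma integral_prob_const: "\<mu> \<in> borel_prob_measures \<Longrightarrow> (\<integral>x. c \<partial>\<mu>) = (c::real)"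
  by (simp add: prob_space.prob_space)

lemma abs_integral_le_bound:
  fixes f :: "'a::topological_space \<Rightarrow> real"
  assumes "\<mu> \<in> borel_prob_measures" "f \<in> borel_measurable borel" "\<And>x. \<bar>f x\<bar> \<le> C"
  shows "\<bar>\<integral>x. f x \<partial>\<mu>\<bar> \<le> C"
proof -
  have "\<bar>\<integral>x. f x \<partial>\<mu>\<bar> \<le> (\<integral>x. \<bar>f x\<bar> \<partial>\<mu>)"
    by (rule integral_abs_bound)
  also have "\<dots> \<le> (\<integral>x. C \<partial>\<mu>)"
    using assms integrable_bounded_borel[OF assms]
    by (intro integral_mono integrable_abs) (auto intro: finite_measure.integrable_const prob_space.finite_measure)
  finally show ?thesis
    using assms(1) by (simp add: prob_space.prob_space)
qed

section \<open>Approximating open sets by continuous functions\<close>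

text \<open>The case distinction is needed since \<open>infdist x {} = 0\<close>.\<close>
definition bump :: "'a::metric_space set \<Rightarrow> nat \<Rightarrow> 'a \<Rightarrow> real" where
  "bump U n x = (if U = UNIV then 1 else min 1 (real n * infdist x (- U)))"

lemma bump_nonneg: "0 \<le> bump U n x"
  by (simp add: bump_def infdist_nonneg)

lemma bump_le_indicator: "bump U n x \<le> indicator U x"
  by (auto simp: bump_def indicator_def)

lemma bump_le_1: "bump U n x \<le> 1"
  by (auto simp: bump_def)

lemma continuous_on_bump: "continuous_on S (bump U n)"
  unfolding bump_def by (cases "U = UNIV") (auto intro!: continuous_intros)

lemma bump_bcontfun: "bump U n \<in> bcontfun"
  by (intro bcontfun_unit_intervalI continuous_on_bump bump_nonneg bump_le_1)

lemma bump_mono: "m \<le> n \<Longrightarrow> bump U m x \<le> bump U n x"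
proof -
  assume "m \<le> n"
  then have "real m * infdist x (- U) \<le> real n * infdist x (- U)"
    by (intro mult_right_mono) (auto simp: infdist_nonneg)
  then show ?thesis by (auto simp: bump_def)
qed

text \<open>Points whose distance to the complement exceeds half that of \<open>x\<close> form a
  neighbourhood on which one \<open>N\<close> serves all. Pointwise convergence of the bumps would
  be too weak for the \<open>smooth\<close> axiom below.\<close>

lemma bump_locally_eventually_1:
  assumes "open U" "x \<in> U"
  obtains S N where "open S" "x \<in> S" "\<And>n y. n \<ge> N \<Longrightarrow> y \<in> S \<Longrightarrow> bump U n y = 1"
proof (cases "U = UNIV")
  case True
  then show ?thesis using that[of UNIV 0] by (auto simp: bump_def)
next
  case False
  define r where "r = infdist x (- U)"
  have "r > 0"
    unfolding r_def using assms False by (intro infdist_pos_not_in_closed) auto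
  then obtain N where N: "real N * (r / 2) > 1"
    using reals_Archimedean3[of "r / 2"] by (metis half_gt_zero)
  let ?S = "{y. infdist y (- U) > r / 2}"
  have "open ?S"
    by (intro open_Collect_less continuous_intros)
  moreover have "x \<in> ?S" using \<open>r > 0\<close> by (simp add: r_def)
  moreover have "bump U n y = 1" if "n \<ge> N" "y \<in> ?S" for n y
  proof -
    have "real N * (r / 2) \<le> real n * infdist y (- U)"
      using that \<open>r > 0\<close> by (intro mult_mono) auto
    then show ?thesis using N False by (simp add: bump_def)
  qed
  ultimately show ?thesis using that by blast
qed

lemma bump_tendsto_indicator:
  assumes "open U"
  shows "(\<lambda>n. bump U n x) \<longlonglongrightarrow> indicator U x"
proof (cases "x \<in> U")
  case True
  then obtain S N where "x \<in> S" "\<And>n y. n \<ge> N \<Longrightarrow> y \<in> S \<Longrightarrow> bump U n y = 1"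
    using assms bump_locally_eventually_1 by metis
  then show ?thesis using True
    by (intro tendsto_eventually) (auto simp: eventually_sequentially)
next
  case False
  then have "bump U n x = 0" for n
    using bump_nonneg[of U n x] bump_le_indicator[of U n x] by simp
  then show ?thesis using False by simp
qed

text \<open>The bumps determine the mass of every open set by dominated convergence, and the open
  sets are an intersection-stable generator.\<close>

lemma borel_prob_measure_eqI:
  fixes \<mu> \<nu> :: "'a::metric_space measure"
  assumes \<mu>: "\<mu> \<in> borel_prob_measures" and \<nu>: "\<nu> \<in> borel_prob_measures"
    and eq: "\<And>f :: 'a \<Rightarrow> real. f \<in> bcontfun \<Longrightarrow> (\<integral>x. f x \<partial>\<mu>) = (\<integral>x. f x \<partial>\<nu>)"
  shows "\<mu> = \<nu>"
proof (rule measure_eqI_generator_eq[where E = "{S. open S}" and \<Omega> = UNIV and A = "\<lambda>_. UNIV"])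
  have lim: "(\<lambda>n. \<integral>x. bump U n x \<partial>M) \<longlonglongrightarrow> measure M U"
    if M: "M \<in> borel_prob_measures" and "open U" for M :: "'a measure" and U
  proof -
    from M interpret prob_space M by simp
    have "(\<lambda>n. \<integral>x. bump U n x \<partial>M) \<longlonglongrightarrow> (\<integral>x. indicator U x \<partial>M)"
    proof (rule integral_dominated_convergence[where w = "\<lambda>_. 1"])
      show "bump U n \<in> borel_measurable M" for n
        using M by (intro bcontfun_borel_measurable bump_bcontfun) auto
    qed (use M \<open>open U\<close> in \<open>auto intro: borel_measurable_indicator AE_I2 bump_tendsto_indicator simp: bump_nonneg bump_le_1\<close>)
    then show ?thesis
      using M \<open>open U\<close> by (simp add: borel_prob_measures_space)
  qed
  show "emeasure \<mu> U = emeasure \<nu> U" if "U \<in> {S. open S}" for U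
  proof -
    have "measure \<mu> U = measure \<nu> U"
      using lim[OF \<mu>, of U] lim[OF \<nu>, of U] that eq[OF bump_bcontfun[of U]] LIMSEQ_unique by simp
    then show ?thesis
      using \<mu> \<nu> by (simp add: finite_measure.emeasure_eq_measure prob_space.finite_measure)
  qed
  show "emeasure \<mu> UNIV \<noteq> \<infinity>"
    using \<mu> by (simp add: finite_measure.emeasure_finite prob_space.finite_measure)
  show "sets \<mu> = sigma_sets UNIV {S. open S}" "sets \<nu> = sigma_sets UNIV {S. open S}"
    using \<mu> \<nu> by (auto simp: borel_def)
qed (auto simp: Int_stable_def)

section \<open>Representation of smooth functionals by measures\<close>

lemma
  fixes f :: "'a::topological_space \<Rightarrow> real"
  assumes "f \<in> bcontfun"
  shows open_bcontfun_less: "open {x. f x < c}"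
    and open_bcontfun_greater: "open {x. c < f x}"
  using open_Collect_less[OF bcontfun_continuous[OF assms] continuous_on_const]
    open_Collect_less[OF continuous_on_const bcontfun_continuous[OF assms]] by auto

text \<open>\<open>smooth\<close> is Daniell's condition with pointwise convergence to 0
  strengthened: each point has a neighbourhood on which the functions vanish from some index on. For
  integrals it follows by dominated convergence.\<close>

locale smooth_functional =
  fixes \<Lambda> :: "('a::metric_space \<Rightarrow> real) \<Rightarrow> real"
  assumes add: "f \<in> bcontfun \<Longrightarrow> g \<in> bcontfun \<Longrightarrow> \<Lambda> (\<lambda>x. f x + g x) = \<Lambda> f + \<Lambda> g"
    and cmult: "f \<in> bcontfun \<Longrightarrow> \<Lambda> (\<lambda>x. c * f x) = c * \<Lambda> f"
    and mono: "f \<in> bcontfun \<Longrightarrow> g \<in> bcontfun \<Longrightarrow> (\<And>x. f x \<le> g x) \<Longrightarrow> \<Lambda> f \<le> \<Lambda> g"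
    and one: "\<Lambda> (\<lambda>_. 1) = 1"
    and smooth: "(\<And>n. F n \<in> bcontfun) \<Longrightarrow> (\<And>n x. 0 \<le> F n x) \<Longrightarrow> (\<And>x. F 0 x \<le> 1) \<Longrightarrow>
      (\<And>n x. F (Suc n) x \<le> F n x) \<Longrightarrow>
      (\<And>x. \<exists>S N. open S \<and> x \<in> S \<and> (\<forall>n\<ge>N. \<forall>y\<in>S. F n y = 0)) \<Longrightarrow>
      (\<lambda>n. \<Lambda> (F n)) \<longlonglongrightarrow> 0"
begin

lemma diff: "f \<in> bcontfun \<Longrightarrow> g \<in> bcontfun \<Longrightarrow> \<Lambda> (\<lambda>x. f x - g x) = \<Lambda> f - \<Lambda> g"
  using add[of "\<lambda>x. f x - g x" g] by (simp add: minus_cont)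

lemma const: "\<Lambda> (\<lambda>_. c) = c"
  using cmult[OF const_bcontfun[of 1], of c] one by simp

lemma nonneg: "f \<in> bcontfun \<Longrightarrow> (\<And>x. 0 \<le> f x) \<Longrightarrow> 0 \<le> \<Lambda> f"
  using mono[OF const_bcontfun[of 0], of f] const[of 0] by simp

lemma sum:
  assumes "\<And>i. i \<in> I \<Longrightarrow> f i \<in> bcontfun"
  shows "\<Lambda> (\<lambda>x. \<Sum>i\<in>I. f i x) = (\<Sum>i\<in>I. \<Lambda> (f i))"
  using assms
proof (induction I rule: infinite_finite_induct)
  case (insert i I)
  then show ?case
    using add[of "f i" "\<lambda>x. \<Sum>i\<in>I. f i x"] bcontfun_sum[of I f] by simp
qed (auto simp: const)

section \<open>The outer measure generated by the functional\<close>

definition below :: "'a set \<Rightarrow> ('a \<Rightarrow> real) set" where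
  "below U = {f \<in> bcontfun. \<forall>x. 0 \<le> f x \<and> f x \<le> indicator U x}"

definition open_mass :: "'a set \<Rightarrow> ennreal" where
  "open_mass U = (SUP f\<in>below U. ennreal (\<Lambda> f))"

definition outer :: "'a set \<Rightarrow> ennreal" where
  "outer A = (INF U\<in>{U. open U \<and> A \<subseteq> U}. open_mass U)"

lemma belowD:
  assumes "f \<in> below U"
  shows "f \<in> bcontfun" "0 \<le> f x" "f x \<le> indicator U x" "f x \<le> 1" "x \<notin> U \<Longrightarrow> f x = 0"
proof -
  from assms have "f \<in> bcontfun" and *: "0 \<le> f x" "f x \<le> indicator U x"
    by (auto simp: below_def)
  then show "f \<in> bcontfun" "0 \<le> f x" "f x \<le> indicator U x" "f x \<le> 1" "x \<notin> U \<Longrightarrow> f x = 0"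
    using order_trans[OF *(2) indicator_le_1] by auto
qed

lemma belowI:
  "f \<in> bcontfun \<Longrightarrow> (\<And>x. 0 \<le> f x) \<Longrightarrow> (\<And>x. f x \<le> 1) \<Longrightarrow> (\<And>x. x \<notin> U \<Longrightarrow> f x = 0) \<Longrightarrow> f \<in> below U"
  by (auto simp: below_def indicator_def)

lemma zero_below: "(\<lambda>_. 0) \<in> below U"
  by (auto simp: below_def const_bcontfun)

lemma bump_below: "bump U n \<in> below U"
  by (simp add: below_def bump_bcontfun bump_nonneg bump_le_indicator)

lemma open_mass_upper: "f \<in> below U \<Longrightarrow> ennreal (\<Lambda> f) \<le> open_mass U"
  unfolding open_mass_def by (rule SUP_upper)

lemma open_mass_mono: "U \<subseteq> V \<Longrightarrow> open_mass U \<le> open_mass V"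
  unfolding open_mass_def
  using belowD by (intro SUP_subset_mono subsetI belowI) (blast | simp)+

lemma open_mass_UNIV: "open_mass UNIV = 1"
proof (rule antisym)
  show "open_mass UNIV \<le> 1"
    unfolding open_mass_def
    using mono[OF _ const_bcontfun[of 1]] one by (intro SUP_least) (auto simp: below_def)
  show "1 \<le> open_mass UNIV"
    using open_mass_upper[of "\<lambda>_. 1" UNIV] one by (simp add: below_def const_bcontfun)
qed

lemma open_mass_empty: "open_mass {} = 0"
proof -
  have "\<Lambda> f = 0" if "f \<in> below {}" for f
  proof -
    have "f = (\<lambda>_. 0)" using belowD(5)[OF that] by auto
    then show ?thesis using const[of 0] by simp
  qed
  then show ?thesis unfolding open_mass_def by (intro antisym SUP_least) auto
qed

text \<open>Subtracting \<open>e\<close> moves the support into the closed set \<open>{x. e \<le> f x}\<close>.\<close>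
lemma truncate:
  assumes "f \<in> below U" "e \<ge> 0"
  shows "(\<lambda>x. max 0 (f x - e)) \<in> below U" "\<Lambda> f \<le> \<Lambda> (\<lambda>x. max 0 (f x - e)) + e"
proof -
  note f = belowD[OF assms(1)]
  show *: "(\<lambda>x. max 0 (f x - e)) \<in> below U"
  proof (rule belowI)
    have "max 0 (f x - e) \<le> 1" for x
      using f(4)[of x] assms(2) by simp
    moreover have "continuous_on UNIV (\<lambda>x. max 0 (f x - e))"
      by (intro continuous_on_max continuous_on_diff continuous_on_const bcontfun_continuous[OF f(1)])
    ultimately show "(\<lambda>x. max 0 (f x - e)) \<in> bcontfun" "\<And>x. max 0 (f x - e) \<le> 1"
      using bcontfun_unit_intervalI[of "\<lambda>x. max 0 (f x - e)"] by simp_all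
  qed (use f assms(2) in auto)
  have "\<Lambda> f \<le> \<Lambda> (\<lambda>x. max 0 (f x - e) + e)"
    using f belowD(1)[OF *] by (intro mono bcontfun_intros) auto
  also have "\<dots> = \<Lambda> (\<lambda>x. max 0 (f x - e)) + e"
    using belowD(1)[OF *] by (simp add: add const_bcontfun const)
  finally show "\<Lambda> f \<le> \<Lambda> (\<lambda>x. max 0 (f x - e)) + e" .
qed

text \<open>After truncation, the part of \<open>g\<close> not yet covered by the bumps vanishes
  locally from some index on: inside some \<open>U i\<close> because its bump reaches 1, outside the
  union because \<open>f\<close> is small there and \<open>g\<close> is 0 nearby. By
  \<open>smooth\<close>, finitely many bumps then carry all but \<open>e\<close> of the value of
  \<open>f\<close>.\<close>

lemma open_mass_countably_subadditive:
  fixes U :: "nat \<Rightarrow> 'a set"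
  assumes U: "\<And>i. open (U i)"
  shows "open_mass (\<Union>i. U i) \<le> (\<Sum>i. open_mass (U i))"
  unfolding open_mass_def[of "\<Union>i. U i"]
proof (rule SUP_least)
  fix f assume f: "f \<in> below (\<Union>i. U i)"
  show "ennreal (\<Lambda> f) \<le> (\<Sum>i. open_mass (U i))"
  proof (rule ennreal_le_epsilon)
    fix e :: real assume e: "0 < e"
    define g where "g = (\<lambda>x. max 0 (f x - e / 2))"
    have g: "g \<in> below (\<Union>i. U i)" and fg: "\<Lambda> f \<le> \<Lambda> g + e / 2"
      using truncate[OF f, of "e / 2"] e by (auto simp: g_def)
    note gD = belowD[OF g]
    \<comment> \<open>The index \<open>n\<close> plays two roles, the number of sets in use and the
      steepness of their bumps, so that a single sequence exhausts the union.\<close>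
    define s where "s = (\<lambda>n x. min 1 (\<Sum>i<n. bump (U i) n x))"
    have s_bcont: "s n \<in> bcontfun" for n
      unfolding s_def
      by (intro bcontfun_unit_intervalI continuous_intros continuous_on_bump)
        (auto intro!: sum_nonneg bump_nonneg)
    have s_bounds: "0 \<le> s n x" "s n x \<le> 1" for n x
      by (auto simp: s_def intro!: sum_nonneg bump_nonneg)
    have s_mono: "s n x \<le> s (Suc n) x" for n x
    proof -
      have "(\<Sum>i<n. bump (U i) n x) \<le> (\<Sum>i<n. bump (U i) (Suc n) x)"
        by (intro sum_mono bump_mono) auto
      also have "\<dots> \<le> (\<Sum>i<Suc n. bump (U i) (Suc n) x)"
        by (simp add: bump_nonneg)
      finally show ?thesis by (auto simp: s_def)
    qed
    define F where "F = (\<lambda>n x. g x * (1 - s n x))"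
    have F_bcont: "F n \<in> bcontfun" for n
      unfolding F_def by (intro bcontfun_intros gD s_bcont)
    have "(\<lambda>n. \<Lambda> (F n)) \<longlonglongrightarrow> 0"
    proof (rule smooth[OF F_bcont])
      show "0 \<le> F n x" for n x
        using gD s_bounds by (simp add: F_def)
      show "F 0 x \<le> 1" for x
        using gD by (simp add: F_def s_def)
      show "F (Suc n) x \<le> F n x" for n x
        unfolding F_def using gD s_mono[of n x] by (intro mult_left_mono) auto
      show "\<exists>S N. open S \<and> x \<in> S \<and> (\<forall>n\<ge>N. \<forall>y\<in>S. F n y = 0)" for x
      proof (cases "x \<in> (\<Union>i. U i)")
        case True
        then obtain i where "x \<in> U i" by auto
        then obtain S N where S: "open S" "x \<in> S" "\<And>n y. n \<ge> N \<Longrightarrow> y \<in> S \<Longrightarrow> bump (U i) n y = 1"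
          by (rule bump_locally_eventually_1[OF U[of i]]) blast
        have "F n y = 0" if "n \<ge> max N (Suc i)" "y \<in> S" for n y
        proof -
          have "1 = bump (U i) n y" using S that by simp
          also have "\<dots> \<le> (\<Sum>i<n. bump (U i) n y)"
            using that by (intro member_le_sum bump_nonneg) auto
          finally show ?thesis by (simp add: F_def s_def)
        qed
        then show ?thesis using S by blast
      next
        case False
        have "open {y. f y < e / 2}"
          by (rule open_bcontfun_less[OF belowD(1)[OF f]])
        moreover have "x \<in> {y. f y < e / 2}"
          using belowD(5)[OF f False] e by simp
        moreover have "F n y = 0" if "y \<in> {y. f y < e / 2}" for n y
          using that by (simp add: F_def g_def)
        ultimately show ?thesis by blast
      qed
    qed
    then obtain n where n: "\<Lambda> (F n) < e / 2"
      using e order_tendstoD(2)[of "\<lambda>n. \<Lambda> (F n)" 0 sequentially "e / 2"]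
      by (auto simp: eventually_sequentially)
    have "\<Lambda> g \<le> \<Lambda> (\<lambda>x. F n x + (\<Sum>i<n. bump (U i) n x))"
    proof (intro mono bcontfun_intros F_bcont gD bump_bcontfun)
      fix x
      have "g x = F n x + g x * s n x"
        by (simp add: F_def algebra_simps)
      also have "g x * s n x \<le> 1 * s n x"
        using gD s_bounds by (intro mult_right_mono) auto
      also have "1 * s n x \<le> (\<Sum>i<n. bump (U i) n x)"
        by (simp add: s_def)
      finally show "g x \<le> F n x + (\<Sum>i<n. bump (U i) n x)" by simp
    qed
    also have "\<dots> = \<Lambda> (F n) + (\<Sum>i<n. \<Lambda> (bump (U i) n))"
      by (simp add: add sum F_bcont bump_bcontfun bcontfun_sum)
    finally have "\<Lambda> f \<le> (\<Sum>i<n. \<Lambda> (bump (U i) n)) + e"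
      using n fg by simp
    then have "ennreal (\<Lambda> f) \<le> ennreal ((\<Sum>i<n. \<Lambda> (bump (U i) n)) + e)"
      by (rule ennreal_leI)
    also have "\<dots> = (\<Sum>i<n. ennreal (\<Lambda> (bump (U i) n))) + ennreal e"
      using e by (simp add: ennreal_plus sum_nonneg nonneg bump_bcontfun bump_nonneg sum_ennreal)
    also have "\<dots> \<le> (\<Sum>i<n. open_mass (U i)) + ennreal e"
      by (intro add_right_mono sum_mono open_mass_upper bump_below)
    also have "\<dots> \<le> (\<Sum>i. open_mass (U i)) + ennreal e"
      by (intro add_right_mono sum_le_suminf) auto
    finally show "ennreal (\<Lambda> f) \<le> (\<Sum>i. open_mass (U i)) + ennreal e" .
  qed
qed

lemma outer_le: "open U \<Longrightarrow> A \<subseteq> U \<Longrightarrow> outer A \<le> open_mass U"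
  unfolding outer_def by (rule INF_lower) auto

lemma outer_open: "open U \<Longrightarrow> outer U = open_mass U"
  by (rule antisym[OF outer_le]) (auto simp: outer_def intro!: INF_greatest open_mass_mono)

lemma outer_close:
  assumes "e > 0"
  obtains U where "open U" "A \<subseteq> U" "open_mass U \<le> outer A + ennreal e"
proof -
  \<comment> \<open>Finiteness is what makes adding \<open>e\<close> a strict increase in
    \<open>ennreal\<close>.\<close>
  have "outer A \<le> 1"
    using outer_le[of UNIV A] open_mass_UNIV by simp
  then have "outer A < outer A + ennreal e"
    using assms ennreal_add_left_cancel_less[of "outer A" 0 "ennreal e"] by (auto simp: top_unique)
  then obtain U where "open U" "A \<subseteq> U" "open_mass U < outer A + ennreal e"
    unfolding outer_def INF_less_iff by auto
  then show ?thesis using that[of U] by simp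
qed

lemma outer_measure_space_outer: "outer_measure_space UNIV outer"
  unfolding outer_measure_space_def
proof (intro conjI)
  show "positive UNIV outer"
    using outer_open[of "{}"] open_mass_empty by (simp add: positive_def)
  show "increasing UNIV outer"
    unfolding increasing_def outer_def by (auto intro!: INF_superset_mono)
  show "countably_subadditive UNIV outer"
    unfolding countably_subadditive_def
  proof safe
    fix A :: "nat \<Rightarrow> 'a set"
    show "outer (\<Union>i. A i) \<le> (\<Sum>i. outer (A i))"
    proof (rule ennreal_le_epsilon)
      fix e :: real assume e: "0 < e"
      have "\<exists>U. open U \<and> A i \<subseteq> U \<and> open_mass U \<le> outer (A i) + ennreal (e * (1 / 2) ^ Suc i)" for i
        using outer_close[of "e * (1 / 2) ^ Suc i" "A i"] e by (metis half_gt_zero_iff mult_pos_pos zero_less_one zero_less_power)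
      then obtain U where U: "\<And>i. open (U i)" "\<And>i. A i \<subseteq> U i"
        "\<And>i. open_mass (U i) \<le> outer (A i) + ennreal (e * (1 / 2) ^ Suc i)"
        by metis
      have "outer (\<Union>i. A i) \<le> open_mass (\<Union>i. U i)"
        using U by (intro outer_le) auto
      also have "\<dots> \<le> (\<Sum>i. open_mass (U i))"
        by (rule open_mass_countably_subadditive) (rule U)
      also have "\<dots> \<le> (\<Sum>i. outer (A i) + ennreal (e * (1 / 2) ^ Suc i))"
        by (intro suminf_le U) auto
      also have "\<dots> = (\<Sum>i. outer (A i)) + (\<Sum>i. ennreal (e * (1 / 2) ^ Suc i))"
        by (rule suminf_add[symmetric]) auto
      also have "(\<Sum>i. ennreal (e * (1 / 2) ^ Suc i)) = ennreal e"
        using e sums_mult[OF power_half_series, of e]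
        by (subst suminf_ennreal2) (auto simp: sums_iff simp del: power_Suc)
      finally show "outer (\<Union>i. A i) \<le> (\<Sum>i. outer (A i)) + ennreal e" .
    qed
  qed
qed

text \<open>A function below \<open>W\<close> vanishes off \<open>W\<close> and \<open>g\<close>
  vanishes on \<open>W\<close>, so their sum stays at most 1 and is again admissible for
  \<open>V\<close>.\<close>

lemma open_mass_disjoint_add:
  assumes g: "g \<in> below V" and W: "W \<subseteq> V" "\<And>x. x \<in> W \<Longrightarrow> g x = 0"
  shows "ennreal (\<Lambda> g) + open_mass W \<le> open_mass V"
proof -
  have "ennreal (\<Lambda> g) + open_mass W = (SUP h\<in>below W. ennreal (\<Lambda> g) + ennreal (\<Lambda> h))"
    unfolding open_mass_def using zero_below by (intro ennreal_SUP_add_right) auto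
  also have "\<dots> \<le> open_mass V"
  proof (rule SUP_least)
    fix h assume h: "h \<in> below W"
    note D = belowD[OF g] belowD[OF h]
    have "(\<lambda>x. g x + h x) \<in> below V"
    proof (rule belowI)
      show "g x + h x \<le> 1" for x
        using D(4,9,10)[of x] W(2)[of x] by (cases "x \<in> W") auto
      show "g x + h x = 0" if "x \<notin> V" for x
        using D(5,10)[of x] W(1) that by auto
    qed (use D in \<open>auto intro: plus_cont\<close>)
    then show "ennreal (\<Lambda> g) + ennreal (\<Lambda> h) \<le> open_mass V"
      using open_mass_upper[of "\<lambda>x. g x + h x" V] D by (simp add: add nonneg)
  qed
  finally show ?thesis .
qed

text \<open>The Caratheodory condition is first checked on open test sets \<open>V\<close>. A
  function below \<open>V \<inter> U\<close>, lowered by \<open>e\<close>, vanishes on the open set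
  \<open>W\<close>, which contains \<open>V - U\<close>; so the disjoint additivity above applies at
  a cost of \<open>e\<close>. General test sets follow by taking open supersets.\<close>

lemma open_in_lambda_system:
  assumes U: "open U"
  shows "U \<in> lambda_system UNIV UNIV outer"
proof -
  have split: "open_mass (V \<inter> U) + outer (V - U) \<le> open_mass V" if V: "open V" for V
  proof -
    have "open_mass (V \<inter> U) + outer (V - U) = (SUP f\<in>below (V \<inter> U). ennreal (\<Lambda> f) + outer (V - U))"
      unfolding open_mass_def using zero_below by (intro ennreal_SUP_add_left[symmetric]) auto
    also have "\<dots> \<le> open_mass V"
    proof (rule SUP_least)
      fix f assume f: "f \<in> below (V \<inter> U)"
      show "ennreal (\<Lambda> f) + outer (V - U) \<le> open_mass V"
      proof (rule ennreal_le_epsilon)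
        fix e :: real assume e: "0 < e"
        define g where "g = (\<lambda>x. max 0 (f x - e))"
        have g: "g \<in> below (V \<inter> U)" and fg: "\<Lambda> f \<le> \<Lambda> g + e"
          using truncate[OF f, of e] e by (auto simp: g_def)
        define W where "W = V \<inter> {x. f x < e}"
        have "open W"
          unfolding W_def by (rule open_Int[OF V open_bcontfun_less[OF belowD(1)[OF f]]])
        moreover have "V - U \<subseteq> W"
          using belowD(5)[OF f] e by (auto simp: W_def)
        ultimately have "outer (V - U) \<le> open_mass W"
          by (rule outer_le)
        moreover have "ennreal (\<Lambda> f) \<le> ennreal (\<Lambda> g) + ennreal e"
          using fg e belowD[OF g] by (simp flip: ennreal_plus add: nonneg ennreal_leI)
        ultimately have "ennreal (\<Lambda> f) + outer (V - U) \<le> (ennreal (\<Lambda> g) + ennreal e) + open_mass W"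
          by (rule add_mono[rotated])
        also have "\<dots> = (ennreal (\<Lambda> g) + open_mass W) + ennreal e"
          by (simp add: ac_simps)
        also have "ennreal (\<Lambda> g) + open_mass W \<le> open_mass V"
        proof (rule open_mass_disjoint_add)
          show "g \<in> below V"
            using belowD[OF g] by (intro belowI) auto
        qed (auto simp: W_def g_def)
        finally show "ennreal (\<Lambda> f) + outer (V - U) \<le> open_mass V + ennreal e"
          by (simp add: add_right_mono)
      qed
    qed
    finally show ?thesis .
  qed
  interpret sigma_algebra UNIV "UNIV :: 'a set set"
    using sigma_algebra_Pow[of "UNIV :: 'a set"] by simp
  have "outer (A \<inter> U) + outer (A - U) = outer A" for A
  proof (rule antisym)
    show "outer (A \<inter> U) + outer (A - U) \<le> outer A"
      unfolding outer_def[of A]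
    proof (rule INF_greatest)
      fix V assume V: "V \<in> {V. open V \<and> A \<subseteq> V}"
      have "outer (A \<inter> U) + outer (A - U) \<le> open_mass (V \<inter> U) + outer (V - U)"
        using V U outer_measure_space_outer
        by (intro add_mono outer_le) (auto simp: outer_measure_space_def intro!: increasingD[of UNIV outer])
      also have "\<dots> \<le> open_mass V"
        using V by (intro split) auto
      finally show "outer (A \<inter> U) + outer (A - U) \<le> open_mass V" .
    qed
    have "subadditive UNIV outer"
      using outer_measure_space_outer countably_subadditive_subadditive
      by (auto simp: outer_measure_space_def)
    moreover have "(A \<inter> U) \<inter> (A - U) = {}" "(A \<inter> U) \<union> (A - U) = A" by auto
    ultimately show "outer A \<le> outer (A \<inter> U) + outer (A - U)"
      using subadditiveD[of UNIV outer "A \<inter> U" "A - U"] by simp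
  qed
  then show ?thesis by (simp add: lambda_system_eq)
qed

section \<open>The representing measure and its integral\<close>

definition repr :: "'a measure" where
  "repr = measure_of UNIV (sets borel) outer"

lemma sets_repr [simp]: "sets repr = sets borel"
  unfolding repr_def using sets.sigma_sets_eq[of borel] by simp

text \<open>Caratheodory makes \<open>outer\<close> a measure on its lambda system, a sigma-algebra
  that contains the open sets and hence all Borel sets.\<close>

lemma emeasure_repr: "A \<in> sets borel \<Longrightarrow> emeasure repr A = outer A"
proof -
  assume A: "A \<in> sets borel"
  interpret P: sigma_algebra UNIV "UNIV :: 'a set set"
    using sigma_algebra_Pow[of "UNIV :: 'a set"] by simp
  have L: "measure_space UNIV (lambda_system UNIV UNIV outer) outer"
    by (rule P.caratheodory_lemma[OF outer_measure_space_outer])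
  then interpret L: sigma_algebra UNIV "lambda_system UNIV UNIV outer"
    by (simp add: measure_space_def)
  have borel: "sigma_algebra UNIV (sets borel :: 'a set set)"
    using sets.sigma_algebra_axioms[of borel] by simp
  have "sets borel \<subseteq> lambda_system UNIV UNIV outer"
    unfolding borel_def using open_in_lambda_system
    by (auto intro!: L.sigma_sets_subset)
  then have "measure_space UNIV (sets borel) outer"
    using measure_down[OF L borel] by simp
  then show ?thesis
    unfolding repr_def using A by (intro emeasure_measure_of_sigma) (auto simp: measure_space_def)
qed

lemma repr_prob: "repr \<in> borel_prob_measures"
proof -
  have "emeasure repr (space repr) = 1"
    using emeasure_repr[of UNIV] outer_open[of UNIV] open_mass_UNIV sets_eq_imp_space_eq[OF sets_repr] by simp
  then show ?thesis by (auto intro: prob_spaceI)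
qed

lemma functional_le_measure:
  assumes "open U" "f \<in> below U"
  shows "\<Lambda> f \<le> measure repr U"
proof -
  interpret prob_space repr using repr_prob by simp
  have "ennreal (\<Lambda> f) \<le> ennreal (measure repr U)"
    using open_mass_upper[OF assms(2)] assms(1)
    by (simp add: emeasure_repr outer_open flip: emeasure_eq_measure)
  then show ?thesis by (simp add: measure_nonneg)
qed

text \<open>Cut \<open>f\<close> into \<open>n\<close> layers of height \<open>1/n\<close>: each layer is dominated by the level set at its bottom and
  dominates the level set at its top.\<close>
lemma functional_le_integral_unit:
  assumes f: "f \<in> bcontfun" "\<And>x. 0 \<le> f x" "\<And>x. f x \<le> 1"
  shows "\<Lambda> f \<le> (\<integral>x. f x \<partial>repr)"
proof (rule field_le_epsilon)
  fix e :: real assume "0 < e"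
  then obtain m where m: "1 / real (Suc m) < e"
    using nat_approx_posE by metis
  define n where "n = Suc m"
  have n: "real n > 0" by (simp add: n_def)
  define L where "L = (\<lambda>k x. min (f x) (real (Suc k) / n) - min (f x) (real k / n))"
  define U where "U = (\<lambda>k. {x. real k / n < f x})"
  have frac: "real (Suc k) / n = real k / n + 1 / n" for k
    by (simp add: add_divide_distrib)
  have L_cont: "continuous_on UNIV (L k)" for k
    unfolding L_def by (intro continuous_intros bcontfun_continuous f)
  have L_bounds: "0 \<le> L k x" "L k x \<le> 1 / n" "x \<notin> U k \<Longrightarrow> L k x = 0" "x \<in> U (Suc k) \<Longrightarrow> L k x = 1 / n" for k x
  proof -
    define d where "d = 1 / real n"
    have "d > 0" using n by (simp add: d_def)
    then show "0 \<le> L k x" "L k x \<le> 1 / n" "x \<notin> U k \<Longrightarrow> L k x = 0" "x \<in> U (Suc k) \<Longrightarrow> L k x = 1 / n"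
      unfolding L_def U_def frac d_def[symmetric] by (auto simp: min_def)
  qed
  have L_bcont: "L k \<in> bcontfun" for k
    using L_bounds by (intro bcontfun_normI[where b = "1 / n"] L_cont) auto
  have f_eq: "f = (\<lambda>x. \<Sum>k<n. L k x)"
  proof
    fix x
    have "(\<Sum>k<n. L k x) = min (f x) (real n / n) - min (f x) (real 0 / n)"
      unfolding L_def by (rule sum_lessThan_telescope)
    then show "f x = (\<Sum>k<n. L k x)" using f n by simp
  qed
  have U_open: "open (U k)" for k
    unfolding U_def by (rule open_bcontfun_greater[OF f(1)])
  have upper: "\<Lambda> (L k) \<le> measure repr (U k) / n" for k
  proof -
    have "(\<lambda>x. n * L k x) \<in> below (U k)"
      using L_bounds[where k = k] n by (intro belowI bcontfun_cmult L_bcont) (auto simp: field_simps)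
    from functional_le_measure[OF U_open this] show ?thesis
      using n by (simp add: cmult L_bcont field_simps)
  qed
  interpret prob_space repr using repr_prob by simp
  have lower: "measure repr (U (Suc k)) / n \<le> (\<integral>x. L k x \<partial>repr)" for k
  proof -
    have "measure repr (U (Suc k)) / n = (\<integral>x. indicator (U (Suc k)) x / n \<partial>repr)"
      using U_open by (simp add: borel_prob_measures_space[OF repr_prob])
    also have "\<dots> \<le> (\<integral>x. L k x \<partial>repr)"
      using U_open L_bounds
      by (intro integral_mono integrable_bcontfun[OF repr_prob L_bcont] integrable_divide_zero
          integrable_real_indicator) (auto simp: indicator_def emeasure_eq_measure)
    finally show ?thesis .
  qed
  have "\<Lambda> f = (\<Sum>k<n. \<Lambda> (L k))"
    by (subst f_eq) (simp add: sum L_bcont)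
  also have "\<dots> \<le> (\<Sum>k<n. measure repr (U k) / n)"
    by (intro sum_mono upper)
  \<comment> \<open>Upper bounds involve \<open>U k\<close> and lower bounds
    \<open>U (Suc k)\<close>. After the shift only the term of \<open>U 0\<close> has no partner,
    and it costs at most \<open>1 / n\<close>, which is below \<open>e\<close>.\<close>
  also have "\<dots> = measure repr (U 0) / n + (\<Sum>k<m. measure repr (U (Suc k)) / n)"
    unfolding n_def by (rule sum.lessThan_Suc_shift)
  also have "\<dots> \<le> 1 / n + (\<Sum>k<m. \<integral>x. L k x \<partial>repr)"
    using n by (intro add_mono sum_mono lower divide_right_mono) auto
  also have "\<dots> \<le> 1 / n + (\<Sum>k<n. \<integral>x. L k x \<partial>repr)"
    using L_bounds by (simp add: n_def)
  also have "(\<Sum>k<n. \<integral>x. L k x \<partial>repr) = (\<integral>x. (\<Sum>k<n. L k x) \<partial>repr)"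
    by (rule Bochner_Integration.integral_sum[symmetric]) (rule integrable_bcontfun[OF repr_prob L_bcont])
  also have "\<dots> = (\<integral>x. f x \<partial>repr)"
    by (simp only: f_eq[symmetric])
  finally show "\<Lambda> f \<le> (\<integral>x. f x \<partial>repr) + e"
    using m by (simp add: n_def)
qed

text \<open>One inequality is enough: rescale \<open>f\<close> to values in [0,1] and apply the
  previous lemma to both \<open>g\<close> and \<open>1 - g\<close>.\<close>

lemma integral_repr:
  assumes "f \<in> bcontfun"
  shows "(\<integral>x. f x \<partial>repr) = \<Lambda> f"
proof -
  obtain C where C: "C > 0" "\<And>x. \<bar>f x\<bar> \<le> C"
    using bcontfun_boundE[OF assms] by metis
  define g where "g = (\<lambda>x. (1 / (2 * C)) * (f x + C))"
  have bounds: "0 \<le> g x" "g x \<le> 1" for x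
    using C(1) C(2)[of x] by (auto simp: g_def field_simps)
  have g: "g \<in> bcontfun"
    unfolding g_def by (intro bcontfun_intros assms)
  have \<Lambda>g: "\<Lambda> g = (1 / (2 * C)) * (\<Lambda> f + C)"
    unfolding g_def using assms by (subst cmult) (simp_all add: plus_cont const_bcontfun add const)
  have prob: "measure repr (space repr) = 1"
    using repr_prob by (simp add: prob_space.prob_space)
  have int: "(\<integral>x. g x \<partial>repr) = ((\<integral>x. f x \<partial>repr) + C) / (2 * C)"
    unfolding g_def using integrable_bcontfun[OF repr_prob] assms
    by (simp add: integrable_bcontfun[OF repr_prob const_bcontfun] prob)
  have "\<Lambda> (\<lambda>x. 1 - g x) \<le> (\<integral>x. 1 - g x \<partial>repr)"
    using bounds by (intro functional_le_integral_unit bcontfun_intros g) auto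
  then have "(\<integral>x. g x \<partial>repr) \<le> \<Lambda> g"
    using integrable_bcontfun[OF repr_prob] g
    by (simp add: diff const const_bcontfun integrable_bcontfun[OF repr_prob const_bcontfun] prob)
  moreover have "\<Lambda> g \<le> (\<integral>x. g x \<partial>repr)"
    using functional_le_integral_unit[OF g bounds] .
  ultimately show ?thesis
    using C(1) unfolding \<Lambda>g int by (simp add: field_simps)
qed

end

section \<open>Limits of smooth functionals are smooth\<close>

text \<open>Alexandrov's theorem, by a gliding hump argument: if \<open>\<Lambda> (F j) \<ge> R\<close> for all \<open>j\<close>, then infinitely many
  increments \<open>G k\<close> of \<open>F\<close> carry mass \<open>R/2\<close> at infinitely many times. Distributing them over \<open>p\<close> residue
  classes gives \<open>p\<close> functions with sum at most 1 and \<open>\<Lambda>\<close>-mass at least \<open>R/2\<close> each.\<close>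
lemma smooth_functional_limit:
  fixes L :: "nat \<Rightarrow> ('a::metric_space \<Rightarrow> real) \<Rightarrow> real"
  assumes L: "\<And>n. smooth_functional (L n)"
    and lim: "\<And>f. f \<in> bcontfun \<Longrightarrow> (\<lambda>n. L n f) \<longlonglongrightarrow> \<Lambda> f"
  shows "smooth_functional \<Lambda>"
proof -
  note sf = smooth_functional.add[OF L] smooth_functional.cmult[OF L] smooth_functional.mono[OF L]
    smooth_functional.one[OF L]
  have add: "\<Lambda> (\<lambda>x. f x + g x) = \<Lambda> f + \<Lambda> g" if "f \<in> bcontfun" "g \<in> bcontfun" for f g
    using tendsto_add[OF lim[OF that(1)] lim[OF that(2)]] lim[OF plus_cont[OF that]] that
    by (simp add: sf LIMSEQ_unique)
  have cmult: "\<Lambda> (\<lambda>x. c * f x) = c * \<Lambda> f" if "f \<in> bcontfun" for c f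
    using tendsto_mult_left[OF lim[OF that], of c] lim[OF bcontfun_cmult[OF that, of c]] that
    by (simp add: sf LIMSEQ_unique)
  have mono: "\<Lambda> f \<le> \<Lambda> g" if "f \<in> bcontfun" "g \<in> bcontfun" "\<And>x. f x \<le> g x" for f g
    using lim[OF that(1)] lim[OF that(2)] by (rule LIMSEQ_le) (use sf that in auto)
  have one: "\<Lambda> (\<lambda>_. 1) = 1"
    using lim[OF const_bcontfun[of 1]] by (simp add: sf LIMSEQ_const_iff)
  have "(\<lambda>n. \<Lambda> (F n)) \<longlonglongrightarrow> 0"
    if F: "\<And>n. F n \<in> bcontfun" "\<And>n x. 0 \<le> F n x" "\<And>x. F 0 x \<le> 1" "\<And>n x. F (Suc n) x \<le> F n x"
      and loc: "\<And>x. \<exists>S N. open S \<and> x \<in> S \<and> (\<forall>n\<ge>N. \<forall>y\<in>S. F n y = 0)" for F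
  proof -
    have F_anti: "F n x \<le> F m x" if "m \<le> n" for m n x
      using that F(4) by (rule lift_Suc_antimono_le[rotated])
    have \<Lambda>F_nonneg: "0 \<le> \<Lambda> (F n)" for n
      using mono[OF const_bcontfun[of 0] F(1), of n] cmult[OF const_bcontfun[of 1], of 0] F(2) by simp
    have \<Lambda>F_anti: "\<Lambda> (F n) \<le> \<Lambda> (F m)" if "m \<le> n" for m n
      by (intro mono F F_anti that)
    have "\<exists>j. \<Lambda> (F j) < R" if R: "R > 0" for R
    proof (rule ccontr)
      assume "\<not> ?thesis"
      then have ge: "R \<le> \<Lambda> (F j)" for j by (auto simp: not_less)
      \<comment> \<open>The order of choices matters: first a late time \<open>n\<close> at which
        \<open>L n (F j)\<close> is still above 3R/4, then, by smoothness of this fixed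
        \<open>L n\<close>, an index \<open>j'\<close> at which it has dropped below R/4.\<close>
      have "\<exists>n j'. n \<ge> k \<and> j' > j \<and> R / 2 \<le> L n (F j) - L n (F j')" for k j
      proof -
        have "eventually (\<lambda>n. 3 * R / 4 < L n (F j)) sequentially"
          using order_tendstoD(1)[OF lim[OF F(1)], of "3 * R / 4" j] R ge[of j] by simp
        then obtain N where "\<And>n. n \<ge> N \<Longrightarrow> 3 * R / 4 < L n (F j)"
          by (auto simp: eventually_sequentially)
        then have n: "max N k \<ge> k" "3 * R / 4 < L (max N k) (F j)" by auto
        define n where "n = max N k"
        have "eventually (\<lambda>j'. L n (F j') < R / 4) sequentially"
          using order_tendstoD(2)[OF smooth_functional.smooth[OF L F loc], of "R / 4"] R by simp
        then obtain M where "\<And>j'. j' \<ge> M \<Longrightarrow> L n (F j') < R / 4"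
          by (auto simp: eventually_sequentially)
        then have "L n (F (max M (Suc j))) < R / 4" by auto
        then show ?thesis
          using n unfolding n_def[symmetric] by (intro exI[of _ n] exI[of _ "max M (Suc j)"]) auto
      qed
      then obtain t q where tq: "\<And>k j. t k j \<ge> k" "\<And>k j. q k j > j"
        "\<And>k j. R / 2 \<le> L (t k j) (F j) - L (t k j) (F (q k j))"
        by metis
      define J where "J = rec_nat 0 q"
      have J_Suc: "J (Suc k) = q k (J k)" for k by (simp add: J_def)
      have "strict_mono J"
        by (rule strict_monoI_Suc) (simp add: J_Suc tq)
      then have J_ge: "k \<le> J k" for k by (rule strict_mono_imp_increasing)
      define G where "G = (\<lambda>k x. F (J k) x - F (J (Suc k)) x)"
      have G_bcont: "G k \<in> bcontfun" for k
        unfolding G_def by (intro minus_cont F)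
      have G_nonneg: "0 \<le> G k x" for k x
        unfolding G_def using F_anti[of "J k" "J (Suc k)" x] tq(2)[where j = "J k" and k = k]
        by (simp add: J_Suc less_imp_le)
      have LG: "R / 2 \<le> L (t k (J k)) (G k)" for k
        using tq(3)[where j = "J k" and k = k] smooth_functional.diff[OF L F(1) F(1)]
        by (simp add: G_def J_Suc)
      \<comment> \<open>With this many classes, masses of at least R/2 each add up to more than
        \<open>\<Lambda> (\<lambda>_. 1) = 1\<close>.\<close>
      obtain p :: nat where p: "real p * (R / 2) > 1"
        using reals_Archimedean3[of "R / 2"] R by (metis half_gt_zero)
      then have "p > 0" by (cases p) auto
      define \<psi> where "\<psi> = (\<lambda>s x. \<Sum>k. if k mod p = s then G k x else 0)"
      \<comment> \<open>Since \<open>J k \<ge> k\<close>, all increments from the local index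
        \<open>N\<close> on vanish on \<open>S\<close>. The series is thus locally a finite sum,
        which gives continuity and lets the total telescope.\<close>
      have finite_sum: "\<exists>S N. open S \<and> x \<in> S \<and>
          (\<forall>y\<in>S. F (J N) y = 0 \<and> (\<forall>s. \<psi> s y = (\<Sum>k<N. if k mod p = s then G k y else 0)))" for x
      proof -
        obtain S N where S: "open S" "x \<in> S" "\<And>n y. n \<ge> N \<Longrightarrow> y \<in> S \<Longrightarrow> F n y = 0"
          using loc[of x] by auto
        have "F (J k) y = 0" if "k \<ge> N" "y \<in> S" for k y
          using S(3)[of "J k" y] J_ge[of k] that by simp
        then have "G k y = 0" if "k \<ge> N" "y \<in> S" for k y
          using that by (simp add: G_def)
        then have "\<psi> s y = (\<Sum>k<N. if k mod p = s then G k y else 0)" if "y \<in> S" for s y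
          unfolding \<psi>_def using that by (intro suminf_finite) auto
        then show ?thesis using S J_ge[of N] by blast
      qed
      have \<psi>_nonneg: "0 \<le> \<psi> s x" and G_le: "G k x \<le> \<psi> (k mod p) x" and \<psi>_sum: "(\<Sum>s<p. \<psi> s x) \<le> 1"
        for s k x
      proof -
        obtain N where N: "F (J N) x = 0" "\<And>s. \<psi> s x = (\<Sum>k<N. if k mod p = s then G k x else 0)"
          using finite_sum[of x] by auto
        show "0 \<le> \<psi> s x"
          unfolding N(2) by (intro sum_nonneg) (auto simp: G_nonneg)
        show "G k x \<le> \<psi> (k mod p) x"
        proof (cases "k < N")
          case True
          then have "(if k mod p = k mod p then G k x else 0) \<le> \<psi> (k mod p) x"
            unfolding N(2) by (intro member_le_sum[where i = k]) (auto simp: G_nonneg)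
          then show ?thesis by simp
        next
          case False
          then have "F (J k) x \<le> F (J N) x"
            using \<open>strict_mono J\<close> by (intro F_anti) (simp add: strict_mono_less_eq)
          then have "G k x \<le> 0"
            using N(1) F(2)[of "J (Suc k)" x] by (simp add: G_def)
          also have "0 \<le> \<psi> (k mod p) x"
            unfolding N(2) by (intro sum_nonneg) (auto simp: G_nonneg)
          finally show ?thesis .
        qed
        have "(\<Sum>s<p. \<psi> s x) = (\<Sum>k<N. \<Sum>s<p. if k mod p = s then G k x else 0)"
          unfolding N(2) by (rule sum.swap)
        also have "\<dots> = (\<Sum>k<N. G k x)"
          using \<open>p > 0\<close> by simp
        also have "\<dots> = F (J 0) x - F (J N) x"
          unfolding G_def by (rule sum_lessThan_telescope')
        also have "\<dots> \<le> 1"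
          using F(3)[of x] N(1) by (simp add: J_def)
        finally show "(\<Sum>s<p. \<psi> s x) \<le> 1" .
      qed
      have \<psi>_bcont: "\<psi> s \<in> bcontfun" if "s < p" for s
      proof (rule bcontfun_unit_intervalI)
        have "isCont (\<psi> s) x" for x
        proof -
          obtain S N where S: "open S" "x \<in> S" "\<And>y. y \<in> S \<Longrightarrow> \<psi> s y = (\<Sum>k<N. if k mod p = s then G k y else 0)"
            using finite_sum[of x] by auto
          have "(\<lambda>y. if k mod p = s then G k y else 0) \<in> bcontfun" for k
            by (cases "k mod p = s") (simp_all add: G_bcont const_bcontfun)
          then have "(\<lambda>y. \<Sum>k<N. if k mod p = s then G k y else 0) \<in> bcontfun"
            by (rule bcontfun_sum)
          then have "isCont (\<lambda>y. \<Sum>k<N. if k mod p = s then G k y else 0) x"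
            using bcontfun_continuous continuous_on_eq_continuous_at[OF open_UNIV] by blast
          then show ?thesis
            using S by (subst isCont_cong[where g = "\<lambda>y. \<Sum>k<N. if k mod p = s then G k y else 0"])
              (auto simp: eventually_nhds)
        qed
        then show "continuous_on UNIV (\<psi> s)"
          by (simp add: continuous_at_imp_continuous_on)
        show "\<psi> s x \<le> 1" for x
          using member_le_sum[of s "{..<p}" "\<lambda>s. \<psi> s x"] that \<psi>_nonneg \<psi>_sum[of x] by force
      qed (rule \<psi>_nonneg)
      \<comment> \<open>The class \<open>s\<close> contains arbitrarily large \<open>k\<close>, and
        \<open>t k (J k) \<ge> k\<close>, so the bound R/2 holds at arbitrarily late times and
        survives in the limit. The witness \<open>s + p * M\<close> is in the class and at least
        \<open>M\<close>.\<close>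
      have "R / 2 \<le> \<Lambda> (\<psi> s)" if s: "s < p" for s
      proof (rule ccontr)
        assume "\<not> ?thesis"
        then have "eventually (\<lambda>n. L n (\<psi> s) < R / 2) sequentially"
          using order_tendstoD(2)[OF lim[OF \<psi>_bcont[OF s]], of "R / 2"] by (simp only: not_le)
        then obtain M where M: "\<And>n. n \<ge> M \<Longrightarrow> L n (\<psi> s) < R / 2"
          by (auto simp: eventually_sequentially)
        define k where "k = s + p * M"
        have "k mod p = s" using s by (simp add: k_def)
        have "M \<le> p * M" using \<open>p > 0\<close> by simp
        then have "M \<le> t k (J k)" using tq(1)[of k "J k"] unfolding k_def by linarith
        then have "L (t k (J k)) (\<psi> s) < R / 2" by (rule M)
        moreover have "L (t k (J k)) (G k) \<le> L (t k (J k)) (\<psi> s)"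
          using G_le[of k] \<open>k mod p = s\<close> by (intro sf G_bcont \<psi>_bcont s) auto
        ultimately show False using LG[of k] by simp
      qed
      then have "(\<Sum>s<p. R / 2) \<le> (\<Sum>s<p. \<Lambda> (\<psi> s))"
        by (intro sum_mono) auto
      also have "\<dots> = \<Lambda> (\<lambda>x. \<Sum>s<p. \<psi> s x)"
      proof -
        have "(\<lambda>n. \<Sum>s<p. L n (\<psi> s)) \<longlonglongrightarrow> (\<Sum>s<p. \<Lambda> (\<psi> s))"
          by (intro tendsto_sum lim \<psi>_bcont) auto
        moreover have "(\<lambda>n. L n (\<lambda>x. \<Sum>s<p. \<psi> s x)) \<longlonglongrightarrow> \<Lambda> (\<lambda>x. \<Sum>s<p. \<psi> s x)"
          by (intro lim bcontfun_sum \<psi>_bcont) auto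
        moreover have "L n (\<lambda>x. \<Sum>s<p. \<psi> s x) = (\<Sum>s<p. L n (\<psi> s))" for n
          by (intro smooth_functional.sum[OF L] \<psi>_bcont) auto
        ultimately show ?thesis by (simp add: LIMSEQ_unique)
      qed
      also have "\<dots> \<le> \<Lambda> (\<lambda>_. 1)"
        using \<psi>_sum by (intro mono bcontfun_sum \<psi>_bcont const_bcontfun) auto
      finally show False using p one by simp
    qed
    then show ?thesis
      using \<Lambda>F_nonneg \<Lambda>F_anti
      by (intro LIMSEQ_I) (auto, metis le_less_trans)
  qed
  then show ?thesis
    by unfold_locales (use add cmult mono one in auto)
qed

section \<open>Splitting a measure along a set\<close>

lemma density_borel_prob_measure:
  fixes w :: "'a::topological_space \<Rightarrow> real"
  assumes M: "M \<in> borel_prob_measures" and w: "w \<in> borel_measurable borel" "\<And>x. 0 \<le> w x" "\<And>x. w x \<le> C"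
    and one: "(\<integral>x. w x \<partial>M) = 1"
  shows "density M w \<in> borel_prob_measures"
    and "f \<in> bcontfun \<Longrightarrow> (\<integral>x. f x \<partial>density M w) = (\<integral>x. w x * f x \<partial>M)"
proof -
  have meas: "w \<in> borel_measurable M"
    using w(1) M by (simp cong: measurable_cong_sets)
  have "integrable M w"
    using integrable_bounded_borel[OF M w(1), of C] w by simp
  then have "(\<integral>\<^sup>+x. ennreal (w x) \<partial>M) = 1"
    using nn_integral_eq_integral[of M w] w(2) one by simp
  then have "emeasure (density M w) (space (density M w)) = 1"
    using meas by (simp add: emeasure_density cong: nn_integral_cong)
  then show "density M w \<in> borel_prob_measures"
    using M by (auto intro: prob_spaceI)
  show "f \<in> bcontfun \<Longrightarrow> (\<integral>x. f x \<partial>density M w) = (\<integral>x. w x * f x \<partial>M)"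
    using M meas w(2) by (subst integral_density) (auto intro: bcontfun_borel_measurable)
qed

text \<open>\<open>\<nu>\<close> is \<open>M\<close> conditioned on \<open>B\<close>. It is split
  off with the prescribed weight \<open>a\<close> rather than with the full mass of
  \<open>B\<close>, so that two measures can be split with equal weights and compared part by
  part.\<close>

lemma split_measure:
  fixes M :: "'a::topological_space measure"
  assumes M: "M \<in> borel_prob_measures" and B: "B \<in> sets borel" and a: "0 < a" "a < 1" "a \<le> measure M B"
  obtains \<nu> \<nu>' where "\<nu> \<in> borel_prob_measures" "\<nu>' \<in> borel_prob_measures"
    "\<And>f. f \<in> bcontfun \<Longrightarrow> (\<integral>x. f x \<partial>M) = a * (\<integral>x. f x \<partial>\<nu>) + (1 - a) * (\<integral>x. f x \<partial>\<nu>')"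
    "\<And>(f :: 'a \<Rightarrow> real) c e. f \<in> bcontfun \<Longrightarrow> (\<And>x. x \<in> B \<Longrightarrow> \<bar>f x - c\<bar> \<le> e) \<Longrightarrow> \<bar>(\<integral>x. f x \<partial>\<nu>) - c\<bar> \<le> e"
proof -
  define b where "b = measure M B"
  have b: "b > 0" "a \<le> b" using a by (auto simp: b_def)
  define w where "w = (\<lambda>x. indicator B x / b :: real)"
  \<comment> \<open>The density of what remains; it is nonnegative because
    \<open>a * w x \<le> a / b \<le> 1\<close>.\<close>
  define w' where "w' = (\<lambda>x. (1 - a * w x) / (1 - a))"
  have meas: "w \<in> borel_measurable borel" "w' \<in> borel_measurable borel"
    unfolding w_def w'_def using B by measurable
  have w_bounds: "0 \<le> w x" "w x \<le> 1 / b" "0 \<le> a * w x" "a * w x \<le> 1" for x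
    using a b by (auto simp: w_def indicator_def)
  have w'_bounds: "0 \<le> w' x" "w' x \<le> 1 / (1 - a)" for x
    using a w_bounds[of x] by (auto simp: w'_def intro!: divide_nonneg_pos divide_right_mono)
  have space: "space M = UNIV" "measure M UNIV = 1"
    using M borel_prob_measures_space[OF M] prob_space.prob_space by force+
  have w_int: "integrable M w"
    using integrable_bounded_borel[OF M meas(1), of "1 / b"] w_bounds by simp
  have "(\<integral>x. w x \<partial>M) = 1"
    unfolding w_def using b M B by (simp add: b_def space)
  note \<nu> = density_borel_prob_measure[OF M meas(1) w_bounds(1,2) this]
  have "(\<integral>x. w' x \<partial>M) = 1"
    unfolding w'_def using a w_int \<open>(\<integral>x. w x \<partial>M) = 1\<close>
    by (simp add: integrable_bcontfun[OF M const_bcontfun] space)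
  note \<nu>' = density_borel_prob_measure[OF M meas(2) w'_bounds this]
  have wf: "integrable M (\<lambda>x. w x * f x)" if f: "f \<in> bcontfun" for f
  proof -
    obtain C where C: "C > 0" "\<And>x. \<bar>f x\<bar> \<le> C" using bcontfun_boundE[OF f] by metis
    have "\<bar>w x * f x\<bar> \<le> 1 / b * C" for x
      unfolding abs_mult using w_bounds[of x] b(1) C by (intro mult_mono) auto
    then show ?thesis
      using bcontfun_borel_measurable[OF f, of borel] meas(1)
      by (intro integrable_bounded_borel[OF M]) auto
  qed
  have decomp: "(\<integral>x. f x \<partial>M) = a * (\<integral>x. f x \<partial>density M w) + (1 - a) * (\<integral>x. f x \<partial>density M w')"
    if f: "f \<in> bcontfun" for f
  proof -
    have f_eq: "f x = a * (w x * f x) + (1 - a) * (w' x * f x)" for x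
    proof -
      have "(1 - a) * w' x = 1 - a * w x" using a by (simp add: w'_def)
      then have "(1 - a) * (w' x * f x) = (1 - a * w x) * f x" by (simp add: mult.assoc[symmetric])
      then show ?thesis by (simp add: algebra_simps)
    qed
    have "(1 - a) * (\<integral>x. w' x * f x \<partial>M) = (\<integral>x. f x - a * (w x * f x) \<partial>M)"
      unfolding integral_mult_right_zero[symmetric] using f_eq
      by (intro Bochner_Integration.integral_cong) (auto simp: eq_diff_eq add.commute)
    also have "\<dots> = (\<integral>x. f x \<partial>M) - a * (\<integral>x. w x * f x \<partial>M)"
      using integrable_bcontfun[OF M f] wf[OF f] by simp
    finally show ?thesis
      using \<nu>(2)[OF f] \<nu>'(2)[OF f] by simp
  qed
  have close: "\<bar>(\<integral>x. f x \<partial>density M w) - c\<bar> \<le> e"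
    if f: "f \<in> bcontfun" and B_close: "\<And>x. x \<in> B \<Longrightarrow> \<bar>f x - c\<bar> \<le> e" for f :: "'a \<Rightarrow> real" and c e
  proof -
    have eq: "(\<integral>x. f x \<partial>density M w) - c = (\<integral>x. w x * (f x - c) \<partial>M)"
      using \<nu>(2)[OF f] \<open>(\<integral>x. w x \<partial>M) = 1\<close> w_int wf[OF f] by (simp add: algebra_simps)
    have "\<bar>\<integral>x. w x * (f x - c) \<partial>M\<bar> \<le> (\<integral>x. \<bar>w x * (f x - c)\<bar> \<partial>M)"
      by (rule integral_abs_bound)
    also have "\<dots> \<le> (\<integral>x. w x * e \<partial>M)"
    proof (rule integral_mono)
      show "integrable M (\<lambda>x. \<bar>w x * (f x - c)\<bar>)"
        using w_int wf[OF f] by (intro integrable_abs) (simp add: right_diff_distrib)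
      show "integrable M (\<lambda>x. w x * e)" using w_int by simp
      show "\<bar>w x * (f x - c)\<bar> \<le> w x * e" for x
        using B_close[of x] w_bounds(1)[of x] b
        by (cases "x \<in> B") (auto simp: abs_mult w_def intro!: mult_left_mono divide_right_mono)
    qed
    also have "\<dots> = e" using \<open>(\<integral>x. w x \<partial>M) = 1\<close> by simp
    finally show ?thesis unfolding eq .
  qed
  show ?thesis
    using \<nu>(1) \<nu>'(1) decomp close by (rule that)
qed

text \<open>Each unit shift exchanges one term at either end. The bound does not depend on
  \<open>N\<close>, so dividing by \<open>N\<close> makes it vanish.\<close>

lemma abs_sum_shift_diff_le:
  fixes s :: "nat \<Rightarrow> real"
  assumes "\<And>j. \<bar>s j\<bar> \<le> C"
  shows "\<bar>(\<Sum>j<N. s (j + i)) - (\<Sum>j<N. s j)\<bar> \<le> 2 * C * real i"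
proof (induction i)
  case (Suc i)
  have "(\<Sum>j<N. s (j + Suc i)) - (\<Sum>j<N. s (j + i)) = s (N + i) - s i"
    using sum_lessThan_telescope[of "\<lambda>j. s (j + i)" N] by (simp add: sum_subtractf)
  then show ?case using Suc assms[of "N + i"] assms[of i] by (simp add: algebra_simps)
qed simp

section \<open>Chains with equicontinuous iterates\<close>

locale equicontinuous_chain =
  fixes \<pi> :: "'a::metric_space \<Rightarrow> 'a measure"
  assumes trans: "transition_function \<pi>"
    and equi: "f \<in> bcontfun \<Longrightarrow> equicontinuous_at {\<lambda>u. \<integral>y. f y \<partial>kernel_iterate \<pi> n u | n. n \<ge> 1} x"
begin

definition P :: "nat \<Rightarrow> ('a \<Rightarrow> real) \<Rightarrow> 'a \<Rightarrow> real" where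
  "P n f x = (\<integral>y. f y \<partial>kernel_iterate \<pi> n x)"

lemma kernel_iterate_prob: "kernel_iterate \<pi> n x \<in> borel_prob_measures"
  using measurable_space[OF kernel_iterate_measurable[OF trans], of x n]
  by (auto simp: space_prob_algebra)

lemma P_0: "f \<in> bcontfun \<Longrightarrow> P 0 f = f"
  by (auto simp: P_def fun_eq_iff intro!: integral_return bcontfun_borel_measurable)

text \<open>The family in the hypothesis starts at \<open>n = 1\<close> and its limit is punctured.
  The case \<open>n = 0\<close> comes from continuity of \<open>f\<close>, the case
  \<open>y = x\<close> is trivial.\<close>

lemma P_equicontinuous:
  assumes f: "f \<in> bcontfun" and e: "e > 0"
  obtains r where "r > 0" "\<And>n y. dist y x < r \<Longrightarrow> \<bar>P n f y - P n f x\<bar> \<le> e"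
proof -
  let ?F = "{\<lambda>u. \<integral>y. f y \<partial>kernel_iterate \<pi> n u | n. n \<ge> 1}"
  have "eventually (\<lambda>y. (SUP g\<in>?F. ennreal \<bar>g y - g x\<bar>) < ennreal e) (at x)"
    using order_tendstoD(2)[OF equi[OF f, unfolded equicontinuous_at_def]] e by simp
  then obtain r where r: "r > 0" "\<And>y. y \<noteq> x \<Longrightarrow> dist y x < r \<Longrightarrow> (SUP g\<in>?F. ennreal \<bar>g y - g x\<bar>) < ennreal e"
    by (auto simp: eventually_at)
  have close: "\<bar>P n f y - P n f x\<bar> \<le> e" if "n \<ge> 1" "dist y x < r" for n y
  proof (cases "y = x")
    case False
    have "P n f \<in> ?F" using that by (auto simp: P_def fun_eq_iff)
    then have "ennreal \<bar>P n f y - P n f x\<bar> \<le> (SUP g\<in>?F. ennreal \<bar>g y - g x\<bar>)"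
      by (rule SUP_upper)
    also have "\<dots> < ennreal e" using r(2) False that by blast
    finally show ?thesis using e by (simp add: ennreal_less_iff less_imp_le)
  qed (use e in simp)
  have "isCont f x"
    using bcontfun_continuous[OF f] continuous_on_eq_continuous_at[OF open_UNIV] by blast
  then obtain s where s: "s > 0" "\<And>y. dist y x < s \<Longrightarrow> dist (f y) (f x) < e"
    unfolding continuous_at_eps_delta using e by metis
  show ?thesis
  proof (rule that[of "min r s"])
    fix n y assume "dist y x < min r s"
    then show "\<bar>P n f y - P n f x\<bar> \<le> e"
      using close[of n y] s(2)[of y] by (cases "n = 0") (auto simp: P_0 f dist_real_def)
  qed (use r s in auto)
qed

lemma P_bound: "f \<in> bcontfun \<Longrightarrow> (\<And>x. \<bar>f x\<bar> \<le> C) \<Longrightarrow> \<bar>P n f x\<bar> \<le> C"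
  unfolding P_def by (intro abs_integral_le_bound[OF kernel_iterate_prob] bcontfun_borel_measurable) auto

text \<open>The Feller property, obtained from equicontinuity of the iterates.\<close>

lemma P_bcontfun:
  assumes f: "f \<in> bcontfun"
  shows "P n f \<in> bcontfun"
proof -
  have "isCont (P n f) x" for x
    unfolding continuous_at_eps_delta
  proof (intro allI impI)
    fix e :: real assume "e > 0"
    then obtain r where r: "r > 0" "\<And>n y. dist y x < r \<Longrightarrow> \<bar>P n f y - P n f x\<bar> \<le> e / 2"
      using P_equicontinuous[OF f, of "e / 2" x] by (metis half_gt_zero)
    have "dist (P n f y) (P n f x) < e" if "dist y x < r" for y
      using r(2)[OF that, of n] \<open>e > 0\<close> by (simp add: dist_real_def)
    then show "\<exists>d>0. \<forall>y. dist y x < d \<longrightarrow> dist (P n f y) (P n f x) < e"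
      using r(1) by blast
  qed
  moreover obtain C where "\<And>x. \<bar>f x\<bar> \<le> C" using bcontfun_boundE[OF f] by metis
  ultimately show ?thesis
    using P_bound[OF f] by (intro bcontfun_normI[where b = C]) (auto simp: continuous_at_imp_continuous_on)
qed

lemma P_integrable: "f \<in> bcontfun \<Longrightarrow> integrable (kernel_iterate \<pi> n x) (f :: 'a \<Rightarrow> real)"
  by (rule integrable_bcontfun[OF kernel_iterate_prob])

lemma P_const: "P n (\<lambda>_. c) x = c"
  unfolding P_def by (rule integral_prob_const[OF kernel_iterate_prob])

lemma P_add: "f \<in> bcontfun \<Longrightarrow> g \<in> bcontfun \<Longrightarrow> P n (\<lambda>x. f x + g x) x = P n f x + P n g x"
  unfolding P_def by (intro Bochner_Integration.integral_add P_integrable)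

lemma P_diff: "f \<in> bcontfun \<Longrightarrow> g \<in> bcontfun \<Longrightarrow> P n (\<lambda>x. f x - g x) x = P n f x - P n g x"
  unfolding P_def by (intro Bochner_Integration.integral_diff P_integrable)

lemma P_cmult: "P n (\<lambda>x. c * f x) x = c * P n f x"
  unfolding P_def by simp

lemma P_divide: "P n (\<lambda>x. f x / c) x = P n f x / c"
  unfolding P_def by simp

lemma P_sum: "(\<And>i. i \<in> I \<Longrightarrow> f i \<in> bcontfun) \<Longrightarrow> P n (\<lambda>x. \<Sum>i\<in>I. f i x) x = (\<Sum>i\<in>I. P n (f i) x)"
  unfolding P_def by (intro Bochner_Integration.integral_sum P_integrable)

lemma P_mono: "f \<in> bcontfun \<Longrightarrow> g \<in> bcontfun \<Longrightarrow> (\<And>x. f x \<le> g x) \<Longrightarrow> P n f x \<le> P n g x"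
  unfolding P_def by (intro integral_mono P_integrable)

lemma bind_kernel_iterate_prob:
  assumes "\<mu> \<in> borel_prob_measures"
  shows "bind \<mu> (kernel_iterate \<pi> n) \<in> borel_prob_measures"
proof -
  have "\<mu> \<in> space (prob_algebra borel)" using assms by (simp add: space_prob_algebra)
  from measurable_space[OF measurable_bind_prob_space[OF measurable_const[OF this] kernel_iterate_measurable[OF trans]]]
  show ?thesis by (fastforce simp: space_prob_algebra)
qed

lemma integral_bind_kernel_iterate:
  assumes \<mu>: "\<mu> \<in> borel_prob_measures" and f: "f \<in> bcontfun"
  shows "(\<integral>x. f x \<partial>bind \<mu> (kernel_iterate \<pi> n)) = (\<integral>x. P n f x \<partial>\<mu>)"
proof -
  obtain C where C: "\<And>x. \<bar>f x\<bar> \<le> C" using bcontfun_boundE[OF f] by metis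
  interpret prob_space \<mu> using \<mu> by simp
  have f_meas: "f \<in> borel_measurable borel" using bcontfun_borel_measurable[OF f] by simp
  have K: "kernel_iterate \<pi> n \<in> \<mu> \<rightarrow>\<^sub>M subprob_algebra borel"
    using measurable_prob_algebraD[OF kernel_iterate_measurable[OF trans], of n] \<mu>
    by (simp cong: measurable_cong_sets)
  have "bind \<mu> (kernel_iterate \<pi> n) = join (distr \<mu> (subprob_algebra borel) (kernel_iterate \<pi> n))"
    by (rule bind_nonempty''[OF K not_empty])
  also have "(\<integral>x. f x \<partial>\<dots>) = (\<integral>M. (\<integral>x. f x \<partial>M) \<partial>distr \<mu> (subprob_algebra borel) (kernel_iterate \<pi> n))"
    using C f_meas K
    by (intro integral_join[where B = C and B' = 1] prob_space.finite_measure prob_space_distr)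
      (auto simp: space_subprob_algebra subprob_space.emeasure_space_le_1 intro!: AE_I2)
  also have "\<dots> = (\<integral>x. P n f x \<partial>\<mu>)"
    unfolding P_def using K f_meas by (intro integral_distr integral_measurable_subprob_algebra)
  finally show ?thesis .
qed

lemma P_Suc: "f \<in> bcontfun \<Longrightarrow> P (Suc n) f x = (\<integral>y. P n f y \<partial>\<pi> x)"
  using integral_bind_kernel_iterate[of "\<pi> x" f n] trans
  by (simp add: P_def transition_function_def)

lemma P_P:
  assumes f: "f \<in> bcontfun"
  shows "P m (P n f) x = P (m + n) f x"
proof (induction m arbitrary: x)
  case 0
  then show ?case by (simp add: P_0 P_bcontfun f)
next
  case (Suc m)
  then show ?case by (simp add: P_Suc P_bcontfun f)
qed

text \<open>Jensen's inequality for the square: the variance of \<open>f\<close> under the law at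
  time \<open>n\<close> is nonnegative.\<close>

lemma P_power2_le:
  assumes f: "f \<in> bcontfun"
  shows "(P n f x)\<^sup>2 \<le> P n (\<lambda>x. (f x)\<^sup>2) x"
proof -
  let ?c = "P n f x"
  have "0 \<le> P n (\<lambda>x. (f x - ?c)\<^sup>2) x"
    unfolding P_def by (intro integral_nonneg_AE) auto
  also have "(\<lambda>x. (f x - ?c)\<^sup>2) = (\<lambda>x. (f x)\<^sup>2 - (2 * ?c) * f x + ?c\<^sup>2)"
    by (auto simp: power2_diff algebra_simps)
  also have "P n \<dots> x = P n (\<lambda>x. (f x)\<^sup>2) x - (2 * ?c) * ?c + ?c\<^sup>2"
    using f by (simp add: P_add P_diff P_cmult P_const bcontfun_intros del: mult.assoc)
  finally show ?thesis by (simp add: power2_eq_square)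
qed

end

section \<open>Asymptotic stability\<close>

locale lower_bound_chain = equicontinuous_chain +
  fixes z :: 'a
  assumes lower_bound: "\<epsilon> > 0 \<Longrightarrow> \<exists>\<alpha>::real. \<alpha> > 0 \<and>
    (\<forall>x. liminf (\<lambda>n. ereal (measure (kernel_iterate \<pi> n x) (ball z \<epsilon>))) \<ge> ereal \<alpha>)"
begin

lemma eventually_ball_mass:
  assumes "r > 0"
  obtains b where "0 < b" "b < 1"
    "\<And>x. eventually (\<lambda>n. b < measure (kernel_iterate \<pi> n x) (ball z r)) sequentially"
proof -
  obtain \<alpha> :: real where \<alpha>: "\<alpha> > 0"
    "\<And>x. liminf (\<lambda>n. ereal (measure (kernel_iterate \<pi> n x) (ball z r))) \<ge> ereal \<alpha>"
    using lower_bound[OF assms] by blast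
  \<comment> \<open>Halving makes the bound strict against \<open>\<alpha>\<close>; the minimum with
    1 gives \<open>b < 1\<close>, which passes to the weight used in
    \<open>split_measure\<close>.\<close>
  define b where "b = min \<alpha> 1 / 2"
  have "b < \<alpha>" "0 < b" "b < 1" using \<alpha>(1) by (auto simp: b_def)
  moreover have "eventually (\<lambda>n. b < measure (kernel_iterate \<pi> n x) (ball z r)) sequentially" for x
  proof -
    have "ereal b < liminf (\<lambda>n. ereal (measure (kernel_iterate \<pi> n x) (ball z r)))"
      using \<alpha>(2)[of x] \<open>b < \<alpha>\<close> by (auto intro: less_le_trans[of _ "ereal \<alpha>"])
    from less_LiminfD[OF this] show ?thesis by simp
  qed
  ultimately show ?thesis using that by blast
qed

text \<open>The level \<open>b\<close> is uniform in the starting point but the time at which it is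
  reached is not. Cutting the masses off at \<open>b\<close> makes them converge pointwise to
  \<open>b\<close>, so their integrals converge to \<open>b\<close> and eventually exceed
  \<open>b / 2\<close>.\<close>

lemma eventually_ball_mass_bind:
  assumes "r > 0"
  obtains a where "0 < a" "a < 1"
    "\<And>\<mu>. \<mu> \<in> borel_prob_measures \<Longrightarrow>
      eventually (\<lambda>n. a < measure (bind \<mu> (kernel_iterate \<pi> n)) (ball z r)) sequentially"
proof -
  obtain b where b: "0 < b" "b < 1"
    "\<And>x. eventually (\<lambda>n. b < measure (kernel_iterate \<pi> n x) (ball z r)) sequentially"
    using eventually_ball_mass[OF assms] by blast
  have "eventually (\<lambda>n. b / 2 < measure (bind \<mu> (kernel_iterate \<pi> n)) (ball z r)) sequentially"
    if \<mu>: "\<mu> \<in> borel_prob_measures" for \<mu>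
  proof -
    let ?m = "\<lambda>n x. measure (kernel_iterate \<pi> n x) (ball z r)"
    have meas: "?m n \<in> borel_measurable borel" for n
      using measurable_compose[OF measurable_prob_algebraD[OF kernel_iterate_measurable[OF trans]]
          measurable_measure_subprob_algebra[of "ball z r" borel]] by simp
    have m_bounds: "0 \<le> ?m n x" "?m n x \<le> 1" for n x
      using kernel_iterate_prob[of n x] by (auto simp: prob_space.prob_le_1)
    have "(\<lambda>n. \<integral>x. min (?m n x) b \<partial>\<mu>) \<longlonglongrightarrow> (\<integral>x. b \<partial>\<mu>)"
    proof (rule integral_dominated_convergence[where w = "\<lambda>_. b"])
      show "(\<lambda>x. min (?m n x) b) \<in> borel_measurable \<mu>" for n
        using meas[of n] \<mu> by (simp cong: measurable_cong_sets)
      show "AE x in \<mu>. (\<lambda>n. min (?m n x) b) \<longlonglongrightarrow> b"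
      proof (intro AE_I2 tendsto_eventually)
        show "eventually (\<lambda>n. min (?m n x) b = b) sequentially" for x
          using b(3)[of x] by eventually_elim simp
      qed
      show "AE x in \<mu>. norm (min (?m n x) b) \<le> b" for n
        using m_bounds b by (intro AE_I2) auto
    qed (use integrable_bcontfun[OF \<mu> const_bcontfun] in auto)
    then have "eventually (\<lambda>n. b / 2 < (\<integral>x. min (?m n x) b \<partial>\<mu>)) sequentially"
      using b integral_prob_const[OF \<mu>, of b] by (intro order_tendstoD(1)[of _ b]) auto
    then show ?thesis
    proof eventually_elim
      case (elim n)
      also have "(\<integral>x. min (?m n x) b \<partial>\<mu>) \<le> (\<integral>x. ?m n x \<partial>\<mu>)"
        using meas[of n] m_bounds b
        by (intro integral_mono integrable_bounded_borel[OF \<mu>, of _ 1]) auto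
      also have "\<dots> = measure (bind \<mu> (kernel_iterate \<pi> n)) (ball z r)"
        using measure_bind_kernel_iterate[OF trans \<mu>, of "ball z r" n] by simp
      finally show ?case .
    qed
  qed
  then show ?thesis using that[of "b / 2"] b by auto
qed

text \<open>Couple a fraction \<open>a\<close> of the mass inside a ball around \<open>z\<close>, where \<open>P n f\<close> is almost constant uniformly in
  \<open>n\<close>, and iterate with the remaining fraction \<open>1 - a\<close>.\<close>
lemma asymptotic_stability:
  assumes f: "f \<in> bcontfun" and \<mu>: "\<mu> \<in> borel_prob_measures" and \<nu>: "\<nu> \<in> borel_prob_measures"
  shows "(\<lambda>n. (\<integral>x. P n f x \<partial>\<mu>) - (\<integral>x. P n f x \<partial>\<nu>)) \<longlonglongrightarrow> 0"
proof (rule LIMSEQ_I)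
  fix e :: real assume e: "0 < e"
  obtain C where C: "C > 0" "\<And>x. \<bar>f x\<bar> \<le> C" using bcontfun_boundE[OF f] by metis
  obtain r where r: "r > 0" "\<And>n y. dist y z < r \<Longrightarrow> \<bar>P n f y - P n f z\<bar> \<le> e / 4"
    using P_equicontinuous[OF f, of "e / 4" z] e by auto
  obtain a where a: "0 < a" "a < 1"
    "\<And>\<mu>. \<mu> \<in> borel_prob_measures \<Longrightarrow>
      eventually (\<lambda>n. a < measure (bind \<mu> (kernel_iterate \<pi> n)) (ball z r)) sequentially"
    using eventually_ball_mass_bind[OF r(1)] by blast
  \<comment> \<open>\<open>2 * C\<close> is the trivial bound before any coupling, and
    \<open>e / 2\<close> is reproduced by every round, as a convex combination with itself. The laws
    are quantified because each round restarts from the remainders, and \<open>N\<close> may depend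
    on them.\<close>
  have contract: "\<exists>N. \<forall>n\<ge>N. \<bar>(\<integral>x. P n f x \<partial>\<mu>) - (\<integral>x. P n f x \<partial>\<nu>)\<bar> \<le> e / 2 + (1 - a) ^ k * (2 * C)"
    if "\<mu> \<in> borel_prob_measures" "\<nu> \<in> borel_prob_measures" for k \<mu> \<nu>
    using that
  proof (induction k arbitrary: \<mu> \<nu>)
    case 0
    have "\<bar>(\<integral>x. P n f x \<partial>M)\<bar> \<le> C" if "M \<in> borel_prob_measures" for n M
      using P_bound[OF f C(2)] bcontfun_borel_measurable[OF P_bcontfun[OF f]]
      by (intro abs_integral_le_bound[OF that]) auto
    from this[OF 0(1)] this[OF 0(2)]
    have "\<bar>(\<integral>x. P n f x \<partial>\<mu>) - (\<integral>x. P n f x \<partial>\<nu>)\<bar> \<le> C + C" for n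
      by (intro order_trans[OF abs_triangle_ineq4] add_mono)
    then show ?case using e by (force intro!: exI[of _ 0] intro: order_trans)
  next
    case (Suc k)
    have "eventually (\<lambda>n. a < measure (bind \<mu> (kernel_iterate \<pi> n)) (ball z r) \<and>
        a < measure (bind \<nu> (kernel_iterate \<pi> n)) (ball z r)) sequentially"
      using a(3) Suc.prems by (intro eventually_conj) auto
    then obtain N where N: "a \<le> measure (bind \<mu> (kernel_iterate \<pi> N)) (ball z r)"
        "a \<le> measure (bind \<nu> (kernel_iterate \<pi> N)) (ball z r)"
      by (auto simp: eventually_sequentially dest: less_imp_le)
    obtain \<mu>1 \<mu>2 where \<mu>s: "\<mu>1 \<in> borel_prob_measures" "\<mu>2 \<in> borel_prob_measures"
      "\<And>g. g \<in> bcontfun \<Longrightarrow> (\<integral>x. g x \<partial>bind \<mu> (kernel_iterate \<pi> N)) = a * (\<integral>x. g x \<partial>\<mu>1) + (1 - a) * (\<integral>x. g x \<partial>\<mu>2)"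
      "\<And>(g :: 'a \<Rightarrow> real) c e. g \<in> bcontfun \<Longrightarrow> (\<And>x. x \<in> ball z r \<Longrightarrow> \<bar>g x - c\<bar> \<le> e) \<Longrightarrow> \<bar>(\<integral>x. g x \<partial>\<mu>1) - c\<bar> \<le> e"
      using split_measure[OF bind_kernel_iterate_prob[OF Suc.prems(1)] _ a(1,2) N(1)] by (auto simp del: mem_ball)
    obtain \<nu>1 \<nu>2 where \<nu>s: "\<nu>1 \<in> borel_prob_measures" "\<nu>2 \<in> borel_prob_measures"
      "\<And>g. g \<in> bcontfun \<Longrightarrow> (\<integral>x. g x \<partial>bind \<nu> (kernel_iterate \<pi> N)) = a * (\<integral>x. g x \<partial>\<nu>1) + (1 - a) * (\<integral>x. g x \<partial>\<nu>2)"
      "\<And>(g :: 'a \<Rightarrow> real) c e. g \<in> bcontfun \<Longrightarrow> (\<And>x. x \<in> ball z r \<Longrightarrow> \<bar>g x - c\<bar> \<le> e) \<Longrightarrow> \<bar>(\<integral>x. g x \<partial>\<nu>1) - c\<bar> \<le> e"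
      using split_measure[OF bind_kernel_iterate_prob[OF Suc.prems(2)] _ a(1,2) N(2)] by (auto simp del: mem_ball)
    obtain N' where N': "\<And>n. n \<ge> N' \<Longrightarrow>
        \<bar>(\<integral>x. P n f x \<partial>\<mu>2) - (\<integral>x. P n f x \<partial>\<nu>2)\<bar> \<le> e / 2 + (1 - a) ^ k * (2 * C)"
      using Suc.IH[OF \<mu>s(2) \<nu>s(2)] by blast
    show ?case
    proof (intro exI allI impI)
      fix n assume n: "n \<ge> N + N'"
      define m where "m = n - N"
      have m: "n = N + m" "m \<ge> N'" using n by (auto simp: m_def)
      let ?I = "\<lambda>M. \<integral>x. P m f x \<partial>M"
      have shift: "(\<integral>x. P n f x \<partial>M) = ?I (bind M (kernel_iterate \<pi> N))" if "M \<in> borel_prob_measures" for M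
        unfolding m(1) using integral_bind_kernel_iterate[OF that P_bcontfun[OF f], of N m]
        by (simp add: P_P f)
      have "\<bar>?I \<mu>1 - P m f z\<bar> \<le> e / 4" "\<bar>?I \<nu>1 - P m f z\<bar> \<le> e / 4"
        using r(2) by (intro \<mu>s(4) \<nu>s(4) P_bcontfun f; simp add: dist_commute)+
      then have near: "\<bar>?I \<mu>1 - ?I \<nu>1\<bar> \<le> e / 2" by linarith
      have "(\<integral>x. P n f x \<partial>\<mu>) - (\<integral>x. P n f x \<partial>\<nu>) = a * (?I \<mu>1 - ?I \<nu>1) + (1 - a) * (?I \<mu>2 - ?I \<nu>2)"
        unfolding shift[OF Suc.prems(1)] shift[OF Suc.prems(2)] \<mu>s(3)[OF P_bcontfun[OF f]] \<nu>s(3)[OF P_bcontfun[OF f]]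
        by (simp add: algebra_simps)
      also have "\<bar>\<dots>\<bar> \<le> \<bar>a * (?I \<mu>1 - ?I \<nu>1)\<bar> + \<bar>(1 - a) * (?I \<mu>2 - ?I \<nu>2)\<bar>"
        by (rule abs_triangle_ineq)
      also have "\<dots> \<le> a * (e / 2) + (1 - a) * (e / 2 + (1 - a) ^ k * (2 * C))"
        using a near N'[OF m(2)] by (auto simp only: abs_mult intro!: add_mono mult_mono)
      also have "\<dots> = e / 2 + (1 - a) ^ Suc k * (2 * C)"
        by (simp add: field_simps)
      finally show "\<bar>(\<integral>x. P n f x \<partial>\<mu>) - (\<integral>x. P n f x \<partial>\<nu>)\<bar> \<le> e / 2 + (1 - a) ^ Suc k * (2 * C)" .
    qed
  qed
  have "(\<lambda>k. (1 - a) ^ k * (2 * C)) \<longlonglongrightarrow> 0"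
    using a by (intro tendsto_mult_left_zero LIMSEQ_realpow_zero) auto
  then have "eventually (\<lambda>k. (1 - a) ^ k * (2 * C) < e / 2) sequentially"
    using e by (intro order_tendstoD(2)[where y = 0]) auto
  then obtain k where "(1 - a) ^ k * (2 * C) < e / 2"
    by (auto simp: eventually_sequentially)
  with contract[OF \<mu> \<nu>, of k]
  show "\<exists>N. \<forall>n\<ge>N. norm ((\<integral>x. P n f x \<partial>\<mu>) - (\<integral>x. P n f x \<partial>\<nu>) - 0) < e"
    by force
qed

section \<open>Convergence of the Cesaro averages\<close>

definition A :: "nat \<Rightarrow> ('a \<Rightarrow> real) \<Rightarrow> 'a \<Rightarrow> real" where
  "A n f x = (\<Sum>i<n. P i f x) / real n"

lemma A_bcontfun: "f \<in> bcontfun \<Longrightarrow> A n f \<in> bcontfun"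
  using bcontfun_cmult[OF bcontfun_sum[of "{..<n}" "\<lambda>i. P i f"], of "1 / real n"] P_bcontfun
  by (auto simp: A_def[abs_def])

lemma A_bound:
  assumes "f \<in> bcontfun" "\<And>x. \<bar>f x\<bar> \<le> C"
  shows "\<bar>A n f x\<bar> \<le> C"
proof (cases "n = 0")
  case True
  then show ?thesis using order_trans[OF abs_ge_zero assms(2)] by (simp add: A_def)
next
  case False
  have "\<bar>\<Sum>i<n. P i f x\<bar> \<le> (\<Sum>i<n. C)"
    by (rule order_trans[OF sum_abs sum_mono]) (rule P_bound[OF assms])
  then show ?thesis using False by (simp add: A_def field_simps)
qed

section \<open>A seminorm along the laws started at \<open>z\<close>\<close>

text \<open>\<open>c\<close> bounds the square of the seminorm. Stating this as an eventual bound
  avoids handling the limsup itself, and infima are taken over the admissible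
  \<open>c\<close>.\<close>

definition asymp_le :: "('a \<Rightarrow> real) \<Rightarrow> real \<Rightarrow> bool" where
  "asymp_le g c \<longleftrightarrow> eventually (\<lambda>k. P k (\<lambda>x. (g x)\<^sup>2) z \<le> c) sequentially"

lemma P_power2_nonneg: "0 \<le> P k (\<lambda>x. (g x)\<^sup>2) x"
  unfolding P_def by (intro integral_nonneg_AE) auto

lemma asymp_le_nonneg: "asymp_le g c \<Longrightarrow> 0 \<le> c"
  unfolding asymp_le_def eventually_sequentially using P_power2_nonneg order_trans by blast

lemma asymp_le_mono: "asymp_le g c \<Longrightarrow> c \<le> d \<Longrightarrow> asymp_le g d"
  unfolding asymp_le_def by (auto elim: eventually_mono)

text \<open>Averaging is a contraction: by Cauchy-Schwarz and Jensen the squared average is at most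
  the average of the \<open>P i\<close> applied to the square, and \<open>P k\<close> turns these
  into values at times \<open>k + i\<close>, all past the threshold.\<close>

lemma asymp_le_A:
  assumes g: "g \<in> bcontfun" and "asymp_le g c" and N: "N > 0"
  shows "asymp_le (A N g) c"
proof -
  obtain K where K: "\<And>k. k \<ge> K \<Longrightarrow> P k (\<lambda>x. (g x)\<^sup>2) z \<le> c"
    using assms(2) by (auto simp: asymp_le_def eventually_sequentially)
  have sq: "(A N g x)\<^sup>2 \<le> (\<Sum>i<N. P i (\<lambda>x. (g x)\<^sup>2) x) / real N" for x
  proof -
    have "(\<Sum>i<N. P i g x)\<^sup>2 \<le> real N * (\<Sum>i<N. (P i g x)\<^sup>2)"
      using sum_squared_le_sum_of_squares[of "\<lambda>i. P i g x" "{..<N}"] by (simp add: mult.commute)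
    also have "\<dots> \<le> real N * (\<Sum>i<N. P i (\<lambda>x. (g x)\<^sup>2) x)"
      by (intro mult_left_mono sum_mono P_power2_le g) auto
    finally show ?thesis
      using N by (simp add: A_def power_divide power2_eq_square field_simps)
  qed
  have "P k (\<lambda>x. (A N g x)\<^sup>2) z \<le> c" if "k \<ge> K" for k
  proof -
    have "P k (\<lambda>x. (A N g x)\<^sup>2) z \<le> P k (\<lambda>x. (1 / real N) * (\<Sum>i<N. P i (\<lambda>x. (g x)\<^sup>2) x)) z"
      using sq by (intro P_mono bcontfun_intros A_bcontfun P_bcontfun g) simp
    also have "\<dots> = (\<Sum>i<N. P (k + i) (\<lambda>x. (g x)\<^sup>2) z) / real N"
      by (simp only: P_cmult) (simp add: P_sum P_P P_bcontfun bcontfun_power2 g)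
    also have "\<dots> \<le> (\<Sum>i<N. c) / real N"
      using K that by (intro divide_right_mono sum_mono) auto
    also have "\<dots> = c" using N by simp
    finally show ?thesis .
  qed
  then show ?thesis by (auto simp: asymp_le_def eventually_sequentially)
qed

lemma asymp_le_perturb:
  assumes g: "g \<in> bcontfun" "\<And>x. \<bar>g x\<bar> \<le> C" and h: "h \<in> bcontfun" "\<And>x. \<bar>h x\<bar> \<le> C"
    and close: "\<And>x. \<bar>h x - g x\<bar> \<le> \<eta>" and "asymp_le g c"
  shows "asymp_le h (c + 2 * C * \<eta>)"
proof -
  have sq: "(h x)\<^sup>2 \<le> (g x)\<^sup>2 + 2 * C * \<eta>" for x
  proof -
    have "(h x)\<^sup>2 - (g x)\<^sup>2 = (h x + g x) * (h x - g x)"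
      by (simp add: power2_eq_square algebra_simps)
    also have "\<dots> \<le> \<bar>h x + g x\<bar> * \<bar>h x - g x\<bar>"
      by (metis abs_ge_self abs_mult)
    also have "\<dots> \<le> (2 * C) * \<eta>"
      using g(2)[of x] h(2)[of x] close[of x] by (intro mult_mono) auto
    finally show ?thesis by simp
  qed
  have "P k (\<lambda>x. (h x)\<^sup>2) z \<le> P k (\<lambda>x. (g x)\<^sup>2) z + 2 * C * \<eta>" for k
    using P_mono[OF bcontfun_power2[OF h(1)] plus_cont[OF bcontfun_power2[OF g(1)] const_bcontfun] sq, of k z]
    by (simp add: P_add bcontfun_power2 g const_bcontfun P_const)
  then show ?thesis
    using assms(6) unfolding asymp_le_def
    by (elim eventually_mono) (meson add_right_mono order_trans)
qed

text \<open>Satisfied by every finite mean of iterates of \<open>f\<close>; it stands for membership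
  in the convex hull of the orbit of \<open>f\<close>. Uniformity in \<open>x\<close> is what
  \<open>asymp_le_perturb\<close> needs.\<close>

definition same_averages :: "('a \<Rightarrow> real) \<Rightarrow> ('a \<Rightarrow> real) \<Rightarrow> bool" where
  "same_averages g f \<longleftrightarrow> (\<forall>e>0. eventually (\<lambda>N. \<forall>x. \<bar>A N g x - A N f x\<bar> \<le> e) sequentially)"

lemma same_averages_P:
  assumes f: "f \<in> bcontfun"
  shows "same_averages (P i f) f"
  unfolding same_averages_def
proof (intro allI impI)
  fix e :: real assume e: "e > 0"
  obtain C where C: "C > 0" "\<And>x. \<bar>f x\<bar> \<le> C" using bcontfun_boundE[OF f] by metis
  obtain M where M: "2 * C * real i < real M * e"
    using reals_Archimedean3[OF e] by blast
  have "\<bar>A N (P i f) x - A N f x\<bar> \<le> e" if N: "N \<ge> M" for N x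
  proof (cases "N = 0")
    case False
    have "A N (P i f) x - A N f x = ((\<Sum>j<N. P (j + i) f x) - (\<Sum>j<N. P j f x)) / real N"
      by (simp add: A_def P_P f diff_divide_distrib)
    also have "\<bar>\<dots>\<bar> \<le> 2 * C * real i / real N"
      unfolding abs_divide using abs_sum_shift_diff_le[where s = "\<lambda>j. P j f x" and C = C and N = N and i = i] P_bound[OF f C(2)]
      by (simp add: divide_right_mono)
    also have "\<dots> \<le> e"
    proof -
      have "real M * e \<le> real N * e" using e N by simp
      then show ?thesis using M False by (simp add: field_simps)
    qed
    finally show ?thesis .
  qed (use e in \<open>simp add: A_def\<close>)
  then show "eventually (\<lambda>N. \<forall>x. \<bar>A N (P i f) x - A N f x\<bar> \<le> e) sequentially"
    by (auto simp: eventually_sequentially)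
qed

lemma same_averages_mean:
  assumes I: "finite I" "I \<noteq> {}" and g: "\<And>i. i \<in> I \<Longrightarrow> g i \<in> bcontfun" "\<And>i. i \<in> I \<Longrightarrow> same_averages (g i) f"
  shows "same_averages (\<lambda>x. (\<Sum>i\<in>I. g i x) / real (card I)) f"
  unfolding same_averages_def
proof (intro allI impI)
  fix e :: real assume e: "e > 0"
  have card: "real (card I) > 0" using I by (simp add: card_gt_0_iff)
  have "eventually (\<lambda>N. \<forall>i\<in>I. \<forall>x. \<bar>A N (g i) x - A N f x\<bar> \<le> e) sequentially"
    using I g(2) e unfolding same_averages_def by (intro eventually_ball_finite) auto
  then show "eventually (\<lambda>N. \<forall>x. \<bar>A N (\<lambda>x. (\<Sum>i\<in>I. g i x) / real (card I)) x - A N f x\<bar> \<le> e) sequentially"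
  proof eventually_elim
    case (elim N)
    show ?case
    proof
      fix x
      have "(\<Sum>j<N. \<Sum>i\<in>I. P j (g i) x) = (\<Sum>i\<in>I. \<Sum>j<N. P j (g i) x)"
        by (rule sum.swap)
      then have "A N (\<lambda>x. (\<Sum>i\<in>I. g i x) / real (card I)) x = (\<Sum>i\<in>I. A N (g i) x) / real (card I)"
        by (simp add: A_def P_divide P_sum g sum_divide_distrib[symmetric])
      then have "A N (\<lambda>x. (\<Sum>i\<in>I. g i x) / real (card I)) x - A N f x
          = (\<Sum>i\<in>I. A N (g i) x - A N f x) / real (card I)"
        using card by (simp add: sum_subtractf diff_divide_distrib)
      also have "\<bar>\<dots>\<bar> \<le> (\<Sum>i\<in>I. e) / real (card I)"
      proof -
        have "\<bar>\<Sum>i\<in>I. A N (g i) x - A N f x\<bar> \<le> (\<Sum>i\<in>I. e)"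
          by (rule order_trans[OF sum_abs sum_mono]) (use elim in blast)
        then show ?thesis unfolding abs_divide using card by (simp add: field_simps)
      qed
      also have "\<dots> = e" using card by simp
      finally show "\<bar>A N (\<lambda>x. (\<Sum>i\<in>I. g i x) / real (card I)) x - A N f x\<bar> \<le> e" .
    qed
  qed
qed

lemma same_averages_A:
  assumes "f \<in> bcontfun" "n > 0"
  shows "same_averages (A n f) f"
  using same_averages_mean[of "{..<n}" "\<lambda>i. P i f" f] assms
  by (simp add: A_def[abs_def] P_bcontfun same_averages_P lessThan_empty_iff)

text \<open>Averaging \<open>g\<close> does not raise its bound, and late averages of
  \<open>g\<close> and \<open>f\<close> are uniformly close. A norm bound found for one mean
  therefore holds, up to \<open>e\<close>, for all late averages of \<open>f\<close>.\<close>

lemma same_averages_asymp_le: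
  assumes f: "f \<in> bcontfun" and g: "g \<in> bcontfun" and same: "same_averages g f"
    and c: "asymp_le g c" and e: "e > 0"
  shows "eventually (\<lambda>N. asymp_le (A N f) (c + e)) sequentially"
proof -
  obtain C1 where C1: "C1 > 0" "\<And>x. \<bar>f x\<bar> \<le> C1" using bcontfun_boundE[OF f] by metis
  obtain C2 where C2: "C2 > 0" "\<And>x. \<bar>g x\<bar> \<le> C2" using bcontfun_boundE[OF g] by metis
  define C where "C = max C1 C2"
  have C: "C > 0" "\<And>x. \<bar>f x\<bar> \<le> C" "\<And>x. \<bar>g x\<bar> \<le> C"
    using C1 C2 by (auto simp: C_def intro: max.coboundedI1 max.coboundedI2)
  have "eventually (\<lambda>N. \<forall>x. \<bar>A N g x - A N f x\<bar> \<le> e / (2 * C)) sequentially"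
    using same e C(1) by (simp add: same_averages_def)
  then show ?thesis
    using eventually_gt_at_top[of 0]
  proof eventually_elim
    case (elim N)
    have "asymp_le (A N f) (c + 2 * C * (e / (2 * C)))"
      by (rule asymp_le_perturb[where g = "A N g"])
        (use elim in \<open>auto intro: A_bcontfun A_bound f g C asymp_le_A c simp: abs_minus_commute\<close>)
    then show ?case using C(1) by simp
  qed
qed

text \<open>The mean ergodic theorem in the seminorm of \<open>asymp_le\<close>: averages of \<open>f\<close> have asymptotically minimal norm
  among all means of averages, so the parallelogram law makes them close to each other at infinitely many
  times \<open>k\<close>. At such a time a fixed part of the mass sits near \<open>z\<close>, where the averages are almost constant.\<close>
lemma Cauchy_A:
  assumes f: "f \<in> bcontfun"
  shows "Cauchy (\<lambda>n. A n f z)"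
proof (rule metric_CauchyI)
  fix e' :: real assume "e' > 0"
  define e where "e = e' / 4"
  have e: "e > 0" using \<open>e' > 0\<close> by (simp add: e_def)
  obtain r where r: "r > 0" "\<And>n y. dist y z < r \<Longrightarrow> \<bar>P n f y - P n f z\<bar> \<le> e"
    using P_equicontinuous[OF f e, of z] by blast
  obtain b where b: "0 < b" "b < 1"
    "\<And>x. eventually (\<lambda>n. b < measure (kernel_iterate \<pi> n x) (ball z r)) sequentially"
    using eventually_ball_mass[OF r(1)] by blast
  \<comment> \<open>The parallelogram law below bounds the squared distance by
    \<open>8 * \<delta>\<close>, half of the mass \<open>e\<^sup>2 * b\<close> that a gap of size
    \<open>e\<close> on the ball would produce.\<close>
  define \<delta> where "\<delta> = e\<^sup>2 * b / 16"
  have \<delta>: "\<delta> > 0" using e b by (simp add: \<delta>_def)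
  \<comment> \<open>\<open>n > 0\<close> excludes \<open>A 0 f\<close>, which is the zero function
    by division by zero and would force the infimum to be 0.\<close>
  define S where "S = {c. \<exists>n>0. asymp_le (A n f) c}"
  define d where "d = Inf S"
  have S_bdd: "bdd_below S"
    using asymp_le_nonneg by (auto simp: S_def intro!: bdd_belowI[of _ 0])
  have "S \<noteq> {}"
  proof -
    obtain C where C: "C > 0" "\<And>x. \<bar>f x\<bar> \<le> C" using bcontfun_boundE[OF f] by metis
    have "(A 1 f x)\<^sup>2 \<le> C\<^sup>2" for x
      using power_mono[OF A_bound[OF f C(2), of 1 x], of 2] by simp
    then have "P k (\<lambda>x. (A 1 f x)\<^sup>2) z \<le> C\<^sup>2" for k
      using P_mono[OF bcontfun_power2[OF A_bcontfun[OF f]] const_bcontfun] P_const by metis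
    then have "asymp_le (A 1 f) (C\<^sup>2)" by (simp add: asymp_le_def)
    then have "C\<^sup>2 \<in> S" unfolding S_def using zero_less_one by blast
    then show ?thesis by blast
  qed
  then obtain c where "c \<in> S" "c < d + \<delta> / 2"
    using cInf_less_iff[OF _ S_bdd, of "d + \<delta> / 2"] \<delta> by (auto simp: d_def)
  then obtain n0 where n0: "n0 > 0" "asymp_le (A n0 f) c" by (auto simp: S_def)
  have "eventually (\<lambda>N. asymp_le (A N f) (c + \<delta> / 2)) sequentially"
    using \<delta> by (intro same_averages_asymp_le[OF f A_bcontfun[OF f] same_averages_A[OF f n0(1)] n0(2)]) auto
  then have "eventually (\<lambda>N. asymp_le (A N f) (d + \<delta>)) sequentially"
    using \<open>c < d + \<delta> / 2\<close> by (elim eventually_mono asymp_le_mono) simp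
  then obtain N0 where N0: "\<And>N. N \<ge> N0 \<Longrightarrow> asymp_le (A N f) (d + \<delta>)"
    by (auto simp: eventually_sequentially)
  have small: "\<bar>A n f z - A m f z\<bar> \<le> 3 * e" if nm: "n \<ge> max N0 1" "m \<ge> max N0 1" for n m
  proof (rule ccontr)
    assume far: "\<not> ?thesis"
    have pos: "n > 0" "m > 0" using nm by auto
    define h where "h = (\<lambda>x. (A n f x + A m f x) / 2)"
    \<comment> \<open>The type \<open>bool\<close> serves as index set for the mean of two
      averages.\<close>
    have "same_averages (\<lambda>x. (\<Sum>i\<in>UNIV. (if i then A n f else A m f) x) / real (card (UNIV :: bool set))) f"
      by (rule same_averages_mean) (auto simp: A_bcontfun f same_averages_A pos)
    then have h_same: "same_averages h f"
      by (simp add: h_def UNIV_bool add.commute)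
    have h: "h \<in> bcontfun"
      using bcontfun_cmult[OF plus_cont[OF A_bcontfun[OF f, of n] A_bcontfun[OF f, of m]], of "1 / 2"]
      by (simp add: h_def)
    \<comment> \<open>The midpoint cannot beat the infimum: such a bound would pass to late averages
      of \<open>f\<close> and put a number smaller than \<open>d\<close> into
      \<open>S\<close>.\<close>
    have "\<not> asymp_le h (d - \<delta>)"
    proof
      assume "asymp_le h (d - \<delta>)"
      then have "eventually (\<lambda>N. asymp_le (A N f) ((d - \<delta>) + \<delta> / 2)) sequentially"
        using \<delta> by (intro same_averages_asymp_le[OF f h h_same]) auto
      then obtain N where "asymp_le (A (max N 1) f) ((d - \<delta>) + \<delta> / 2)"
        unfolding eventually_sequentially by (metis max.cobounded1)
      then have "(d - \<delta>) + \<delta> / 2 \<in> S"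
        unfolding S_def by (auto intro!: exI[of _ "max N 1"])
      then have "d \<le> (d - \<delta>) + \<delta> / 2"
        unfolding d_def using S_bdd by (rule cInf_lower)
      then show False using \<delta> by simp
    qed
    moreover have "eventually (\<lambda>k. P k (\<lambda>x. (A n f x)\<^sup>2) z \<le> d + \<delta> \<and> P k (\<lambda>x. (A m f x)\<^sup>2) z \<le> d + \<delta> \<and>
        b < measure (kernel_iterate \<pi> k z) (ball z r)) sequentially"
      using N0[of n] N0[of m] nm b(3) unfolding asymp_le_def by (intro eventually_conj) auto
    then obtain K where K: "\<And>k. k \<ge> K \<Longrightarrow> P k (\<lambda>x. (A n f x)\<^sup>2) z \<le> d + \<delta> \<and>
        P k (\<lambda>x. (A m f x)\<^sup>2) z \<le> d + \<delta> \<and> b < measure (kernel_iterate \<pi> k z) (ball z r)"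
      unfolding eventually_sequentially by blast
    \<comment> \<open>The failed eventual bound only gives infinitely many times; one of them lies
      past \<open>K\<close>, where the three other conditions hold permanently.\<close>
    ultimately obtain k where "k \<ge> K" and k_h: "P k (\<lambda>x. (h x)\<^sup>2) z > d - \<delta>"
      unfolding asymp_le_def eventually_sequentially not_le[symmetric] by blast
    note k = K[OF \<open>k \<ge> K\<close>]
    define D where "D = (\<lambda>x. A n f x - A m f x)"
    have D: "D \<in> bcontfun" unfolding D_def by (intro minus_cont A_bcontfun f)
    have "(\<lambda>x. (D x)\<^sup>2) = (\<lambda>x. (2 * (A n f x)\<^sup>2 + 2 * (A m f x)\<^sup>2) - 4 * (h x)\<^sup>2)"
      by (auto simp: D_def h_def power2_eq_square field_simps)
    then have "P k (\<lambda>x. (D x)\<^sup>2) z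
        = 2 * P k (\<lambda>x. (A n f x)\<^sup>2) z + 2 * P k (\<lambda>x. (A m f x)\<^sup>2) z - 4 * P k (\<lambda>x. (h x)\<^sup>2) z"
      by (simp add: P_diff P_add P_cmult bcontfun_intros A_bcontfun f h)
    also have "\<dots> < 8 * \<delta>" using k k_h by simp
    also have "8 * \<delta> < e\<^sup>2 * b" using e b by (simp add: \<delta>_def)
    also have "e\<^sup>2 * b \<le> e\<^sup>2 * measure (kernel_iterate \<pi> k z) (ball z r)"
      using k by (intro mult_left_mono) auto
    also have "\<dots> = (\<integral>x. e\<^sup>2 * indicator (ball z r) x \<partial>kernel_iterate \<pi> k z)"
      using borel_prob_measures_space[OF kernel_iterate_prob] by simp
    also have "\<dots> \<le> P k (\<lambda>x. (D x)\<^sup>2) z"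
      unfolding P_def
    proof (rule integral_mono)
      show "integrable (kernel_iterate \<pi> k z) (\<lambda>x. e\<^sup>2 * indicator (ball z r) x)"
        by (intro integrable_bounded_borel[OF kernel_iterate_prob, of _ "e\<^sup>2"] borel_measurable_times
            borel_measurable_const borel_measurable_indicator) (auto simp: indicator_def)
      show "integrable (kernel_iterate \<pi> k z) (\<lambda>x. (D x)\<^sup>2)"
        by (intro P_integrable bcontfun_power2 D)
      show "e\<^sup>2 * indicator (ball z r) x \<le> (D x)\<^sup>2" for x
      proof (cases "x \<in> ball z r")
        case True
        have "\<bar>A N f x - A N f z\<bar> \<le> e" if "N > 0" for N
        proof -
          have "A N f x - A N f z = (\<Sum>i<N. P i f x - P i f z) / real N"
            by (simp add: A_def sum_subtractf diff_divide_distrib)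
          also have "\<bar>\<dots>\<bar> \<le> (\<Sum>i<N. e) / real N"
          proof -
            have "\<bar>\<Sum>i<N. P i f x - P i f z\<bar> \<le> (\<Sum>i<N. e)"
              by (rule order_trans[OF sum_abs sum_mono]) (use r(2)[of x] True in \<open>simp add: dist_commute\<close>)
            then show ?thesis unfolding abs_divide using that by (simp add: field_simps)
          qed
          also have "\<dots> = e" using that by simp
          finally show ?thesis .
        qed
        \<comment> \<open>The gap at \<open>z\<close> exceeds \<open>3 * e\<close> and each of the
          two averages moves by at most \<open>e\<close> on the ball, so a gap of \<open>e\<close>
          is left.\<close>
        from this[OF pos(1)] this[OF pos(2)] have "e \<le> \<bar>D x\<bar>"
          using far by (simp add: D_def)
        then have "e\<^sup>2 \<le> \<bar>D x\<bar>\<^sup>2" using e by (intro power_mono) auto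
        then show ?thesis using True by simp
      qed simp
    qed
    finally show False by simp
  qed
  show "\<exists>M. \<forall>m\<ge>M. \<forall>n\<ge>M. dist (A m f z) (A n f z) < e'"
  proof (intro exI[of _ "max N0 1"] allI impI)
    fix m n assume "m \<ge> max N0 1" "n \<ge> max N0 1"
    then show "dist (A m f z) (A n f z) < e'"
      using small[of m n] \<open>e' > 0\<close> by (simp add: dist_real_def e_def)
  qed
qed

section \<open>The invariant measure\<close>

text \<open>The index is \<open>Suc n\<close> because \<open>A 0\<close> is the zero functional and
  violates the normalisation. Smoothness is dominated convergence under each of the finitely many
  laws.\<close>

lemma smooth_functional_A: "smooth_functional (\<lambda>f. A (Suc n) f z)"
proof
  fix f g :: "'a \<Rightarrow> real" and c :: real assume f: "f \<in> bcontfun"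
  show "A (Suc n) (\<lambda>x. c * f x) z = c * A (Suc n) f z"
    by (simp add: A_def P_cmult sum_distrib_left algebra_simps del: sum.lessThan_Suc)
  assume g: "g \<in> bcontfun"
  show "A (Suc n) (\<lambda>x. f x + g x) z = A (Suc n) f z + A (Suc n) g z"
    by (simp add: A_def P_add f g sum.distrib add_divide_distrib del: sum.lessThan_Suc)
  assume "\<And>x. f x \<le> g x"
  then show "A (Suc n) f z \<le> A (Suc n) g z"
    unfolding A_def by (intro divide_right_mono sum_mono P_mono f g) auto
next
  show "A (Suc n) (\<lambda>_. 1) z = 1"
    by (simp add: A_def P_const del: sum.lessThan_Suc)
next
  fix F :: "nat \<Rightarrow> 'a \<Rightarrow> real"
  assume F: "\<And>n. F n \<in> bcontfun" "\<And>n x. 0 \<le> F n x" "\<And>x. F 0 x \<le> 1" "\<And>n x. F (Suc n) x \<le> F n x"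
    and loc: "\<And>x. \<exists>S N. open S \<and> x \<in> S \<and> (\<forall>n\<ge>N. \<forall>y\<in>S. F n y = 0)"
  have F_le: "F j x \<le> 1" for j x
    using lift_Suc_antimono_le[of "\<lambda>j. F j x" 0 j] F(3,4) by (auto intro: order_trans)
  have F_lim: "(\<lambda>j. F j x) \<longlonglongrightarrow> 0" for x
  proof -
    obtain S N where "x \<in> S" "\<forall>n\<ge>N. \<forall>y\<in>S. F n y = 0" using loc[of x] by blast
    then show ?thesis by (intro tendsto_eventually) (auto simp: eventually_sequentially)
  qed
  have "(\<lambda>j. P i (F j) z) \<longlonglongrightarrow> (\<integral>x. 0 \<partial>kernel_iterate \<pi> i z)" for i
    unfolding P_def
  proof (rule integral_dominated_convergence[where w = "\<lambda>_. 1"])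
    show "F j \<in> borel_measurable (kernel_iterate \<pi> i z)" for j
      using kernel_iterate_prob[of i z] by (intro bcontfun_borel_measurable F) auto
    show "integrable (kernel_iterate \<pi> i z) (\<lambda>_. 1 :: real)"
      by (intro P_integrable const_bcontfun)
  qed (use F F_le F_lim in auto)
  then have "(\<lambda>j. \<Sum>i<Suc n. P i (F j) z) \<longlonglongrightarrow> (\<Sum>i<Suc n. 0)"
    by (intro tendsto_sum) simp
  then show "(\<lambda>j. A (Suc n) (F j) z) \<longlonglongrightarrow> 0"
    unfolding A_def using tendsto_divide[OF _ tendsto_const, of _ 0 sequentially "real (Suc n)"] by simp
qed

definition limit_functional :: "('a \<Rightarrow> real) \<Rightarrow> real" where
  "limit_functional f = lim (\<lambda>n. A (Suc n) f z)"

lemma A_tendsto: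
  assumes "f \<in> bcontfun"
  shows "(\<lambda>n. A (Suc n) f z) \<longlonglongrightarrow> limit_functional f"
proof -
  obtain L where "(\<lambda>n. A n f z) \<longlonglongrightarrow> L"
    using Cauchy_A[OF assms] real_Cauchy_convergent convergent_def by blast
  then have "(\<lambda>n. A (Suc n) f z) \<longlonglongrightarrow> L" by (rule LIMSEQ_Suc)
  then show ?thesis by (simp add: limit_functional_def limI)
qed

sublocale limit: smooth_functional limit_functional
  by (rule smooth_functional_limit[OF smooth_functional_A A_tendsto])

text \<open>Applying \<open>P i\<close> only shifts the averages in time, which changes them by a
  vanishing amount.\<close>

lemma limit_functional_P:
  assumes f: "f \<in> bcontfun"
  shows "limit_functional (P i f) = limit_functional f"
proof -
  have "(\<lambda>n. A (Suc n) (P i f) z - A (Suc n) f z) \<longlonglongrightarrow> 0"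
  proof (rule LIMSEQ_I)
    fix e :: real assume e: "e > 0"
    then have "eventually (\<lambda>N. \<forall>x. \<bar>A N (P i f) x - A N f x\<bar> \<le> e / 2) sequentially"
      using same_averages_P[OF f, of i] half_gt_zero unfolding same_averages_def by blast
    then obtain N where N: "\<And>n x. n \<ge> N \<Longrightarrow> \<bar>A n (P i f) x - A n f x\<bar> \<le> e / 2"
      unfolding eventually_sequentially by blast
    have "\<bar>A (Suc n) (P i f) z - A (Suc n) f z\<bar> < e" if "n \<ge> N" for n
      using N[of "Suc n" z] that e by simp
    then show "\<exists>N. \<forall>n\<ge>N. norm (A (Suc n) (P i f) z - A (Suc n) f z - 0) < e" by auto
  qed
  with tendsto_diff[OF A_tendsto[OF P_bcontfun[OF f]] A_tendsto[OF f]]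
  have "limit_functional (P i f) - limit_functional f = 0"
    by (rule LIMSEQ_unique)
  then show ?thesis by simp
qed

text \<open>Turns the setwise definition into an equation of measures, phrased with
  \<open>kernel_iterate \<pi> 1\<close> so that it can be tested through integrals of
  \<open>P 1 f\<close>.\<close>

lemma invariant_iff_bind:
  "invariant_prob_measure \<pi> \<nu> \<longleftrightarrow> \<nu> \<in> borel_prob_measures \<and> bind \<nu> (kernel_iterate \<pi> 1) = \<nu>"
proof (cases "\<nu> \<in> borel_prob_measures")
  case True
  have "bind \<nu> \<pi> = \<nu> \<longleftrightarrow> (\<forall>A\<in>sets borel. measure (bind \<nu> \<pi>) A = measure \<nu> A)"
  proof
    have prob: "bind \<nu> \<pi> \<in> borel_prob_measures"
      using bind_kernel_iterate_prob[OF True, of 1] unfolding kernel_iterate_1[OF trans] .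
    assume eq: "\<forall>A\<in>sets borel. measure (bind \<nu> \<pi>) A = measure \<nu> A"
    show "bind \<nu> \<pi> = \<nu>"
    proof (rule measure_eqI)
      show "sets (bind \<nu> \<pi>) = sets \<nu>" using prob True by simp
      show "emeasure (bind \<nu> \<pi>) B = emeasure \<nu> B" if "B \<in> sets (bind \<nu> \<pi>)" for B
        using prob True eq that by (simp add: finite_measure.emeasure_eq_measure prob_space.finite_measure)
    qed
  qed simp
  also have "\<dots> \<longleftrightarrow> (\<forall>A\<in>sets borel. (\<integral>x. measure (\<pi> x) A \<partial>\<nu>) = measure \<nu> A)"
    using measure_bind_kernel_iterate[OF trans True, of _ 1, unfolded kernel_iterate_1[OF trans]]
    by (intro ball_cong) auto
  finally show ?thesis
    unfolding kernel_iterate_1[OF trans] invariant_prob_measure_def using True by blast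
qed (auto simp: invariant_prob_measure_def)

lemma invariant_integral_P:
  assumes \<nu>: "invariant_prob_measure \<pi> \<nu>" and f: "f \<in> bcontfun"
  shows "(\<integral>x. P n f x \<partial>\<nu>) = (\<integral>x. f x \<partial>\<nu>)"
  using f
proof (induction n arbitrary: f)
  case (Suc n)
  have "(\<integral>x. P (Suc n) f x \<partial>\<nu>) = (\<integral>x. P n (P 1 f) x \<partial>\<nu>)"
    using P_P[OF Suc.prems, of n 1] by simp
  also have "\<dots> = (\<integral>x. P 1 f x \<partial>\<nu>)"
    by (rule Suc.IH[OF P_bcontfun[OF Suc.prems]])
  also have "\<dots> = (\<integral>x. f x \<partial>\<nu>)"
    using integral_bind_kernel_iterate[OF _ Suc.prems, of \<nu> 1] \<nu> unfolding invariant_iff_bind by metis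
  finally show ?case .
qed (simp add: P_0)

lemma invariant_repr: "invariant_prob_measure \<pi> limit.repr"
  unfolding invariant_iff_bind
proof
  show "limit.repr \<in> borel_prob_measures" by (rule limit.repr_prob)
  show "bind limit.repr (kernel_iterate \<pi> 1) = limit.repr"
    by (intro borel_prob_measure_eqI bind_kernel_iterate_prob limit.repr_prob)
      (simp only: integral_bind_kernel_iterate[OF limit.repr_prob] limit.integral_repr P_bcontfun limit_functional_P)
qed

lemma converges_weakly_invariant:
  assumes \<nu>: "invariant_prob_measure \<pi> \<nu>" and \<mu>: "\<mu> \<in> borel_prob_measures"
  shows "converges_weakly (\<lambda>n. bind \<mu> (kernel_iterate \<pi> n)) \<nu>"
  unfolding converges_weakly_def
proof (intro allI impI)
  fix f :: "'a \<Rightarrow> real" assume f: "f \<in> bcontfun"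
  have "\<nu> \<in> borel_prob_measures" using \<nu> by (simp add: invariant_prob_measure_def)
  from asymptotic_stability[OF f \<mu> this]
  show "(\<lambda>n. \<integral>x. f x \<partial>bind \<mu> (kernel_iterate \<pi> n)) \<longlonglongrightarrow> (\<integral>x. f x \<partial>\<nu>)"
    unfolding invariant_integral_P[OF \<nu> f] integral_bind_kernel_iterate[OF \<mu> f]
    by (rule LIM_zero_cancel)
qed

lemma invariant_unique:
  assumes \<mu>: "invariant_prob_measure \<pi> \<mu>" and \<nu>: "invariant_prob_measure \<pi> \<nu>"
  shows "\<nu> = \<mu>"
proof (rule borel_prob_measure_eqI)
  show prob: "\<mu> \<in> borel_prob_measures" "\<nu> \<in> borel_prob_measures"
    using \<mu> \<nu> by (simp_all add: invariant_prob_measure_def)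
  show "(\<integral>x. f x \<partial>\<nu>) = (\<integral>x. f x \<partial>\<mu>)" if f: "f \<in> bcontfun" for f :: "'a \<Rightarrow> real"
    using asymptotic_stability[OF f prob(2,1)] invariant_integral_P[OF _ f] \<mu> \<nu>
    by (simp add: LIMSEQ_const_iff)
qed

end

theorem theorem4p3:
  fixes \<pi> :: "'a::metric_space \<Rightarrow> 'a measure"
  assumes "transition_function \<pi>"
    and "\<exists>z::'a. \<forall>\<epsilon>::real. \<epsilon> > 0 \<longrightarrow> (\<exists>\<alpha>::real. \<alpha> > 0 \<and>
           (\<forall>x. liminf (\<lambda>n. ereal (measure (kernel_iterate \<pi> n x) (ball z \<epsilon>))) \<ge> ereal \<alpha>))"
    and "\<forall>\<phi> :: 'a \<Rightarrow> real. \<phi> \<in> bcontfun \<longrightarrow>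
           (\<forall>x. equicontinuous_at {\<lambda>u. \<integral>y. \<phi> y \<partial>kernel_iterate \<pi> n u | n. n \<ge> 1} x)"
  shows "\<exists>\<mu>\<^sub>s. invariant_prob_measure \<pi> \<mu>\<^sub>s \<and>
           (\<forall>\<nu>. invariant_prob_measure \<pi> \<nu> \<longrightarrow> \<nu> = \<mu>\<^sub>s) \<and>
           (\<forall>\<mu> \<in> borel_prob_measures.
              converges_weakly (\<lambda>n. bind \<mu> (kernel_iterate \<pi> n)) \<mu>\<^sub>s)"
proof -
  from assms(2) obtain z :: 'a where z: "\<And>\<epsilon>::real. \<epsilon> > 0 \<Longrightarrow> \<exists>\<alpha>::real. \<alpha> > 0 \<and>
      (\<forall>x. liminf (\<lambda>n. ereal (measure (kernel_iterate \<pi> n x) (ball z \<epsilon>))) \<ge> ereal \<alpha>)"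
    by blast
  interpret lower_bound_chain \<pi> z
    by unfold_locales (use assms(1,3) z in blast)+
  show ?thesis
    using invariant_repr invariant_unique converges_weakly_invariant by blast
qed

end
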